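(* Let $p \in \mathbb{R}_{\geq 0}[x_1,\ldots,x_n]$ be a real stable polynomial in $n$ variables, and fix any $\kappa \in \mathbb{Z}^n$ with non-negative entries. If $p(\mathbf{1}) = 1$ and $\|\kappa - \nabla p(\mathbf{1})\|_1 < 1$, then $$\inf_{x_1,\ldots,x_n > 0} \frac{p(x_1,\ldots,x_n)}{x_1^{\kappa_1} \cdots x_n^{\kappa_n}} \geq \left(1 - \|\kappa - \nabla p(\mathbf{1})\|_1\right)^n.$$ Moreover, this bound is tight for any fixed $\kappa$ with strictly positive entries: for every such $\kappa$ and every $\epsilon \in (0,1]$ there is a real stable $p \in \mathbb{R}_{\geq 0}[x_1,\ldots,x_n]$ with $p(\mathbf{1})=1$ and $1-\|\kappa - \nabla p(\mathbf{1})\|_1 = \epsilon$ for which equality holds.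
   Context: $\mathbb{R}_{\ge 0}[x_1,\dots,x_n]$ denotes polynomials with non-negative real coefficients (not necessarily homogeneous). A polynomial $p \in \mathbb{R}[z_1,\dots,z_n]$ is real stable if $p(z) \neq 0$ whenever $\operatorname{Im}(z_i) > 0$ for all $i$. $\mathbf{1}$ is the all-ones vector, $\nabla p(\mathbf 1)$ is the gradient of $p$ at $\mathbf 1$, and $\|\cdot\|_1$ is the $\ell^1$ norm. *)

theory Defs
  imports "HOL-Analysis.Analysis" "HOL-Library.Poly_Mapping"
begin

text \<open>
  Real polynomials in variables indexed by a finite type: a polynomial maps exponent vectors
  to coefficients and is nonzero at only finitely many of them. Addition and multiplication
  are those of \<^typ>\<open>'a \<Rightarrow>\<^sub>0 'b\<close>. The number of variables is the cardinality
  of the index type.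
\<close>
type_synonym 'n rpoly = "('n \<Rightarrow>\<^sub>0 nat) \<Rightarrow>\<^sub>0 real"

text \<open>Evaluation is generic in order to cover both real and complex points.\<close>
definition eval_rpoly :: "'n::finite rpoly \<Rightarrow> 'a::real_normed_field ^ 'n \<Rightarrow> 'a" where
  "eval_rpoly p x =
     (\<Sum>m\<in>Poly_Mapping.keys p.
        of_real (Poly_Mapping.lookup p m) * (\<Prod>i\<in>UNIV. (x $ i) ^ Poly_Mapping.lookup m i))"

definition nonneg_coeffs :: "'n rpoly \<Rightarrow> bool" where
  "nonneg_coeffs p \<longleftrightarrow> (\<forall>m. Poly_Mapping.lookup p m \<ge> 0)"

definition real_stable :: "'n::finite rpoly \<Rightarrow> bool" where
  "real_stable p \<longleftrightarrow>
     (\<forall>z :: complex ^ 'n. (\<forall>i. Im (z $ i) > 0) \<longrightarrow> eval_rpoly p z \<noteq> 0)"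

definition gradient :: "('a::real_inner \<Rightarrow> real) \<Rightarrow> 'a \<Rightarrow> 'a" where
  "gradient f x = (THE D. GDERIV f x :> D)"

definition l1_norm :: "real ^ 'n \<Rightarrow> real" where
  "l1_norm v = (\<Sum>i\<in>UNIV. \<bar>v $ i\<bar>)"

definition real_vec :: "int ^ 'n \<Rightarrow> real ^ 'n" where
  "real_vec k = (\<chi> i. real_of_int (k $ i))"

text \<open>
  The infimum is taken in the reals. It is the true infimum whenever the coefficients of the
  polynomial are nonnegative, since the quotients are then bounded below by 0.
\<close>
definition capacity :: "int ^ 'n::finite \<Rightarrow> 'n rpoly \<Rightarrow> real" where
  "capacity k p =
     (INF x \<in> {x :: real ^ 'n. \<forall>i. x $ i > 0}.
        eval_rpoly p x / (\<Prod>i\<in>UNIV. (x $ i) powi (k $ i)))"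

lemma gradient_eqI:
  assumes "GDERIV f x :> D"
  shows "gradient f x = D"
proof -
  have "E = D" if "GDERIV f x :> E" for E
  proof -
    have "(\<lambda>h. inner h E) = (\<lambda>h. inner h D)"
      using that assms unfolding gderiv_def by (rule has_derivative_unique)
    then show ?thesis
      by (metis inner_commute vector_eq_rdot)
  qed
  then show ?thesis
    unfolding gradient_def using assms by blast
qed

lemma GDERIV_eval_rpoly:
  fixes p :: "'n::finite rpoly" and x :: "real ^ 'n"
  shows "GDERIV (eval_rpoly p) x :> gradient (eval_rpoly p) x"
proof -
  have "eval_rpoly p differentiable (at x)"
  proof -
    have coord: "\<exists>D. ((\<lambda>y :: real ^ 'n. y $ i) has_derivative D) (at x)" for i
      using bounded_linear_vec_nth bounded_linear.has_derivative has_derivative_ident by blast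
    have pow: "\<exists>D. ((\<lambda>y :: real ^ 'n. (y $ i) ^ k) has_derivative D) (at x)" for i k
      using coord[of i] has_derivative_power by blast
    have "\<forall>i m. \<exists>D. ((\<lambda>y :: real ^ 'n. (y $ i) ^ Poly_Mapping.lookup (m :: 'n \<Rightarrow>\<^sub>0 nat) i)
            has_derivative D) (at x)"
      using pow by blast
    then obtain D where D: "\<And>i (m :: 'n \<Rightarrow>\<^sub>0 nat).
        ((\<lambda>y :: real ^ 'n. (y $ i) ^ Poly_Mapping.lookup m i) has_derivative D i m) (at x)"
      by metis
    show ?thesis
      unfolding differentiable_def eval_rpoly_def
      by (rule exI, (rule has_derivative_sum has_derivative_mult_right has_derivative_prod D)+)
  qed
  then obtain f' where f': "(eval_rpoly p has_derivative f') (at x)"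
    unfolding differentiable_def by blast
  then have lin: "linear f'"
    using has_derivative_linear by blast
  have "f' h = inner h (\<chi> i. f' (axis i 1))" for h
  proof -
    have "f' h = f' (\<Sum>i\<in>UNIV. h $ i *\<^sub>R axis i 1)"
      using basis_expansion[of h] by (simp add: scalar_mult_eq_scaleR)
    also have "\<dots> = (\<Sum>i\<in>UNIV. h $ i * f' (axis i 1))"
      using lin by (simp add: linear_sum linear_scale)
    finally show ?thesis
      by (simp add: inner_vec_def)
  qed
  then have "f' = (\<lambda>h. inner h (\<chi> i. f' (axis i 1)))" by blast
  with f' have "GDERIV (eval_rpoly p) x :> (\<chi> i. f' (axis i 1))"
    unfolding gderiv_def by simp
  then show ?thesis
    using gradient_eqI by metis
qed

end

(* Let M_i(x) = x_i (d_i p)(x) / p(x) be the mean of the i-th exponent when the monomials of p are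
   weighted by their values at x. On a line x + s v with v > 0 the quotient (d_i p) / p is a sum of
   terms c / (s - a) with c >= 0 and a <= 0. Hence M_i decreases when other coordinates are raised
   and increases when all of them are scaled up, so it also increases when a set of coordinates
   containing i is scaled up. Move from the vector 1 to x by scaling sets of coordinates, first
   those exceeding 1 upwards, then the others downwards, where each move brings one more coordinate
   to its final position. Since exponents are integers, scaling a set S by t multiplies p by at
   least t^kappa(S) (1 - |kappa(S) - M(S)|), counting only the unfavourable sign of kappa(S) - M(S),
   and monotonicity keeps that defect below its initial bound. This makes at most n factors in
   total. Equality is attained by a product of links eps x_j + (1 - eps) x_(j-1). *)
theory Submission
  imports Defs "HOL-Computational_Algebra.Fundamental_Theorem_Algebra"
begin

section \<open>Logarithmic derivatives of univariate polynomials\<close>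

lemma poly_pderiv_linear_factor:
  fixes q :: "'a :: idom poly"
  shows "poly (pderiv ([:- a, 1:] * q)) x = poly q x + (x - a) * poly (pderiv q) x"
  by (subst pderiv_mult) (simp add: pderiv_pCons algebra_simps)

text \<open>At 0 the logarithmic derivative is the sum of \<open>- inverse a\<close> over the roots
  \<open>a\<close>, and each such term has nonpositive imaginary part when \<open>a\<close> lies in
  the lower half plane. The induction splits off one root at a time.\<close>

lemma Im_logderiv_nonpos:
  fixes P :: "complex poly"
  assumes "\<And>w. poly P w = 0 \<Longrightarrow> Im w < 0"
  shows "Im (poly (pderiv P) 0 / poly P 0) \<le> 0"
  using assms
proof (induction "degree P" arbitrary: P rule: less_induct)
  case less
  show ?case
  proof (cases "degree P = 0")
    case True
    then have "pderiv P = 0" by (simp add: pderiv_eq_0_iff)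
    then show ?thesis by simp
  next
    case False
    then have "\<not> constant (poly P)" by (simp add: constant_degree)
    then obtain a where a: "poly P a = 0" using fundamental_theorem_of_algebra by blast
    then obtain Q where Q: "P = [:-a, 1:] * Q" by (metis poly_eq_0_iff_dvd dvdE)
    have "Q \<noteq> 0" using False Q by auto
    then have "degree Q < degree P" unfolding Q by (subst degree_mult_eq) auto
    moreover have Q_roots: "\<And>w. poly Q w = 0 \<Longrightarrow> Im w < 0" using less.prems Q by simp
    ultimately have IH: "Im (poly (pderiv Q) 0 / poly Q 0) \<le> 0" using less.hyps by blast
    have "Im a < 0" using a less.prems by blast
    then have "a \<noteq> 0" by auto
    have "poly Q 0 \<noteq> 0" using Q_roots[of 0] by auto
    have "poly (pderiv P) 0 / poly P 0 = - inverse a + poly (pderiv Q) 0 / poly Q 0"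
      using \<open>a \<noteq> 0\<close> \<open>poly Q 0 \<noteq> 0\<close> unfolding Q poly_pderiv_linear_factor
      by (simp add: field_simps)
    moreover have "Im (- inverse a) \<le> 0"
      using \<open>Im a < 0\<close> by (simp add: divide_nonpos_nonneg)
    ultimately show ?thesis using IH by simp
  qed
qed

text \<open>Approaching the root \<open>r\<close> along rays sweeps out the whole half plane of directions, so a
  pole of order \<open>m\<close> maps it onto a sector of opening \<open>m * pi\<close>; this forces \<open>m = 1\<close>.\<close>

lemma herglotz_pole_simple:
  fixes k g :: "complex poly" and r :: real
  assumes im: "\<And>s. Im s > 0 \<Longrightarrow> Im (poly g s / poly ([:- of_real r, 1:] ^ m * k) s) \<le> 0"
    and m: "m > 0" and k: "poly k (of_real r) \<noteq> 0" and g: "poly g (of_real r) \<noteq> 0"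
  shows "m = 1" and "\<exists>c\<ge>0. poly g (of_real r) / poly k (of_real r) = of_real c"
proof -
  define \<gamma> where "\<gamma> = poly g (of_real r) / poly k (of_real r)"
  \<comment> \<open>On the ray of direction \<phi> the factor \<open>(s - r) ^ m\<close> equals
    \<open>\<rho> ^ m * cis (m * \<phi>)\<close>. Its positive modulus is dropped and \<rho> tends
    to 0, which leaves a condition on \<gamma> alone.\<close>
  have ray: "Im (\<gamma> * cis (- (real m * \<phi>))) \<le> 0" if \<phi>: "0 < \<phi>" "\<phi> < pi" for \<phi>
  proof -
    define s where "s \<rho> = of_real r + of_real \<rho> * cis \<phi>" for \<rho> :: real
    have neg: "Im (poly g (s \<rho>) / poly k (s \<rho>) * cis (- (real m * \<phi>))) \<le> 0" if "\<rho> > 0" for \<rho>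
    proof -
      have "Im (s \<rho>) > 0" using that \<phi> by (simp add: s_def sin_gt_zero)
      then have "Im (poly g (s \<rho>) / poly ([:- of_real r, 1:] ^ m * k) (s \<rho>)) \<le> 0" by (rule im)
      also have "poly g (s \<rho>) / poly ([:- of_real r, 1:] ^ m * k) (s \<rho>)
          = of_real (1 / \<rho> ^ m) * (poly g (s \<rho>) / poly k (s \<rho>) * cis (- (real m * \<phi>)))"
        using Complex.DeMoivre[of \<phi> m]
        by (simp add: s_def power_mult_distrib divide_inverse flip: cis_inverse)
      finally have "(1 / \<rho> ^ m) * Im (poly g (s \<rho>) / poly k (s \<rho>) * cis (- (real m * \<phi>))) \<le> 0"
        unfolding Im_complex_of_real Re_complex_of_real times_complex.sel by simp
      then show ?thesis using zero_less_power[OF that, of m] by (simp add: mult_le_0_iff divide_le_0_iff zero_le_divide_iff)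
    qed
    have s0: "(s \<longlongrightarrow> of_real r) (at_right 0)"
      unfolding s_def by (rule tendsto_eq_intros refl | simp)+
    have "((\<lambda>\<rho>. Im (poly g (s \<rho>) / poly k (s \<rho>) * cis (- (real m * \<phi>)))) \<longlongrightarrow>
            Im (\<gamma> * cis (- (real m * \<phi>)))) (at_right 0)"
      unfolding \<gamma>_def by (intro tendsto_intros s0 k)
    moreover have "\<forall>\<^sub>F \<rho> in at_right 0.
        Im (poly g (s \<rho>) / poly k (s \<rho>) * cis (- (real m * \<phi>))) \<le> 0"
      using neg by (simp add: eventually_at_right_less eventually_at_filter)
    ultimately show ?thesis
      by (rule tendsto_upperbound) simp
  qed
  \<comment> \<open>The substitution \<open>\<psi> = m * \<phi>\<close> covers the open interval;
    continuity adds the endpoints, since the directions 0 and pi are used below even for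
    \<open>m = 1\<close>.\<close>
  have sector: "Im (\<gamma> * cis (- \<psi>)) \<le> 0" if "0 \<le> \<psi>" "\<psi> \<le> real m * pi" for \<psi>
  proof (rule continuous_le_on_closure[where S = "{0<..<real m * pi}" and f = "\<lambda>\<psi>. Im (\<gamma> * cis (- \<psi>))"])
    show "continuous_on (closure {0<..<real m * pi}) (\<lambda>\<psi>. Im (\<gamma> * cis (- \<psi>)))"
      by (intro continuous_intros)
    show "\<psi> \<in> closure {0<..<real m * pi}"
      using that m by (simp add: closure_greaterThanLessThan)
    fix \<psi> assume "\<psi> \<in> {0<..<real m * pi}"
    then show "Im (\<gamma> * cis (- \<psi>)) \<le> 0"
      using ray[of "\<psi> / real m"] m by (simp add: divide_less_eq mult.commute)
  qed
  have "\<gamma> \<noteq> 0" using k g by (simp add: \<gamma>_def)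
  have "real m * pi \<ge> 1 * pi" using m by (intro mult_right_mono) auto
  \<comment> \<open>The directions 0 and pi bound \<open>Im \<gamma>\<close> from opposite sides, so
    it vanishes; the direction pi/2 gives \<open>Re \<gamma> \<ge> 0\<close>.\<close>
  then have 1: "Im (\<gamma> * cis (- 0)) \<le> 0" "Im (\<gamma> * cis (- pi)) \<le> 0" "Im (\<gamma> * cis (- (pi/2))) \<le> 0"
    by (intro sector; simp)+
  then have Im: "Im \<gamma> = 0" and Re: "Re \<gamma> \<ge> 0" by (simp_all flip: cis_cnj)
  show "m = 1"
  proof (rule ccontr)
    assume "m \<noteq> 1"
    \<comment> \<open>A sector of opening at least 2 pi also contains 3/2 pi, which reverses the
      sign of \<open>Re \<gamma>\<close> and forces \<open>\<gamma> = 0\<close>.\<close>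
    then have "real m * pi \<ge> 2 * pi" using m by (intro mult_right_mono) auto
    then have "Im (\<gamma> * cis (- (3/2 * pi))) \<le> 0" by (intro sector) auto
    then have "Re \<gamma> \<le> 0" by (simp only: cis.simps complex.sel times_complex.sel cos_minus sin_minus cos_3over2_pi sin_3over2_pi)
    then show False using Im Re \<open>\<gamma> \<noteq> 0\<close> by (simp add: complex_eq_iff)
  qed
  show "\<exists>c\<ge>0. poly g (of_real r) / poly k (of_real r) = of_real c"
    using Im Re by (intro exI[of _ "Re \<gamma>"]) (simp add: complex_eq_iff flip: \<gamma>_def)
qed

text \<open>Common roots of \<open>f\<close> and \<open>g\<close> are cancelled by induction on the
  degree. Once none is left, \<open>herglotz_pole_simple\<close> makes every root of
  \<open>f\<close> a simple pole with nonnegative residue, and Lagrange interpolation of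
  \<open>g\<close> at these roots gives the expansion. The degree condition excludes a polynomial
  part.\<close>

lemma herglotz_partial_fractions:
  fixes f g :: "complex poly"
  assumes "f \<noteq> 0" and "g = 0 \<or> degree g < degree f"
    and "\<And>s. poly f s = 0 \<Longrightarrow> s \<in> \<real>"
    and "\<And>s. Im s > 0 \<Longrightarrow> Im (poly g s / poly f s) \<le> 0"
  shows "\<exists>A (c :: real \<Rightarrow> real). finite A \<and> (\<forall>a\<in>A. c a \<ge> 0 \<and> poly f (of_real a) = 0) \<and>
           (\<forall>s. poly f s \<noteq> 0 \<longrightarrow>
              poly g s / poly f s = (\<Sum>a\<in>A. of_real (c a) / (s - of_real a)))"
  using assms
proof (induction "degree f" arbitrary: f g rule: less_induct)
  case less
  show ?case
  proof (cases "\<exists>a. poly f a = 0 \<and> poly g a = 0")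
    case True
    then obtain a where a: "poly f a = 0" "poly g a = 0" by blast
    then obtain f1 g1 where f1: "f = [:-a, 1:] * f1" and g1: "g = [:-a, 1:] * g1"
      by (metis poly_eq_0_iff_dvd dvdE)
    have nz: "f1 \<noteq> 0" using less.prems(1) f1 by auto
    then have deg: "degree f = Suc (degree f1)" unfolding f1 by (subst degree_mult_eq) auto
    have "a \<in> \<real>" using a less.prems by blast
    have quot: "poly g s / poly f s = poly g1 s / poly f1 s" if "s \<noteq> a" for s
      proof -
      have "poly f s = (s - a) * poly f1 s" "poly g s = (s - a) * poly g1 s"
        unfolding f1 g1 by (simp_all add: algebra_simps)
      then show ?thesis using that by simp
    qed
    have "\<exists>A (c :: real \<Rightarrow> real). finite A \<and> (\<forall>a\<in>A. c a \<ge> 0 \<and> poly f1 (of_real a) = 0) \<and>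
           (\<forall>s. poly f1 s \<noteq> 0 \<longrightarrow>
              poly g1 s / poly f1 s = (\<Sum>a\<in>A. of_real (c a) / (s - of_real a)))"
    proof (rule less.hyps)
      show "degree f1 < degree f" "f1 \<noteq> 0" by (use deg nz in auto)
      show "g1 = 0 \<or> degree g1 < degree f1"
        using less.prems(2) deg degree_mult_eq[of "[:-a, 1:]" g1] g1 by (cases "g1 = 0") auto
      show "s \<in> \<real>" if "poly f1 s = 0" for s using less.prems(3) f1 that by simp
      show "Im (poly g1 s / poly f1 s) \<le> 0" if "Im s > 0" for s
      proof -
        \<comment> \<open>At \<open>s = a\<close> the uncancelled quotient would be 0/0, that is 0,
          and say nothing about the reduced one; but \<open>a\<close> is real and \<open>s\<close>
          is not.\<close>
        have "s \<noteq> a" using that \<open>a \<in> \<real>\<close> by (auto simp: complex_is_Real_iff)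
        then show ?thesis using less.prems(4)[OF that] quot by simp
      qed
    qed
    then obtain A and c :: "real \<Rightarrow> real" where "finite A"
      and A: "\<forall>a\<in>A. c a \<ge> 0 \<and> poly f1 (of_real a) = 0"
      and pf: "\<forall>s. poly f1 s \<noteq> 0 \<longrightarrow>
              poly g1 s / poly f1 s = (\<Sum>a\<in>A. of_real (c a) / (s - of_real a))" by blast
    have "\<forall>s. poly f s \<noteq> 0 \<longrightarrow> poly g s / poly f s = (\<Sum>a\<in>A. of_real (c a) / (s - of_real a))"
    proof (intro allI impI)
      fix s assume "poly f s \<noteq> 0"
      then have "poly f1 s \<noteq> 0" "s \<noteq> a" using a by (auto simp: f1)
      then show "poly g s / poly f s = (\<Sum>a\<in>A. of_real (c a) / (s - of_real a))"
        using pf quot by simp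
    qed
    moreover have "\<forall>a\<in>A. c a \<ge> 0 \<and> poly f (of_real a) = 0" using A f1 by simp
    ultimately show ?thesis using \<open>finite A\<close> by blast
  next
    case False
    \<comment> \<open>The multiplicity of the root plays the part of \<open>m\<close> in
      \<open>herglotz_pole_simple\<close>. As it turns out to be 1, the derivative of
      \<open>f\<close> agrees with the cofactor \<open>k\<close> at the root, so the quotient is the
      residue.\<close>
    have root: "poly (pderiv f) (of_real r) \<noteq> 0 \<and>
        (\<exists>c\<ge>0. poly g (of_real r) / poly (pderiv f) (of_real r) = of_real c)"
      if r: "poly f (of_real r) = 0" for r
    proof -
      obtain k where k: "f = [:- of_real r, 1:] ^ order (of_real r) f * k"
        and ndvd: "\<not> [:- of_real r, 1:] dvd k" using order_decomp[OF less.prems(1)] by blast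
      have k0: "poly k (of_real r) \<noteq> 0" using ndvd by (simp add: poly_eq_0_iff_dvd)
      have g0: "poly g (of_real r) \<noteq> 0" using False r by blast
      have ord: "order (of_real r) f > 0" using r less.prems(1) by (simp add: order_root)
      have im: "Im (poly g s / poly ([:- of_real r, 1:] ^ order (of_real r) f * k) s) \<le> 0"
        if "Im s > 0" for s using less.prems(4)[OF that] k by simp
      note simple = herglotz_pole_simple[OF im ord k0 g0]
      have "f = [:- of_real r, 1:] * k" using k simple(1) by simp
      then have "poly (pderiv f) (of_real r) = poly k (of_real r)"
        by (simp add: poly_pderiv_linear_factor del: mult_pCons_left)
      then show ?thesis using simple(2) k0 by simp
    qed
    define Z where "Z = {z. poly f z = 0}"
    have "finite Z" unfolding Z_def using less.prems(1) by (rule poly_roots_finite)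
    have Z_real: "\<exists>r. z = of_real r" if "z \<in> Z" for z
      using less.prems(3)[of z] that by (auto simp: Z_def elim: Reals_cases)
    have sqf: "rsquarefree f"
      unfolding rsquarefree_roots using root Z_real Z_def by blast
    have f_prod: "f = smult (lead_coeff f) (\<Prod>z\<in>Z. [:-z, 1:])"
      unfolding Z_def by (rule complex_poly_decompose_rsquarefree[OF sqf, symmetric])
    have lc: "lead_coeff f \<noteq> 0" using less.prems(1) by simp
    define F where "F z = smult (lead_coeff f) (\<Prod>w\<in>Z - {z}. [:-w, 1:])" for z
    have f_F: "f = [:-z, 1:] * F z" if "z \<in> Z" for z
      by (subst f_prod, subst prod.remove[OF \<open>finite Z\<close> that]) (simp add: F_def)
    have deg_f: "degree f = card Z"
      by (subst f_prod) (use lc in \<open>simp add: degree_prod_sum_eq\<close>)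
    have F_pderiv: "poly (F z) z = poly (pderiv f) z" if "z \<in> Z" for z
      by (subst f_F[OF that]) (simp add: poly_pderiv_linear_factor del: mult_pCons_left)
    have F_other: "poly (F z) w = 0" if "w \<in> Z" "w \<noteq> z" for z w
      using that \<open>finite Z\<close> by (auto simp: F_def poly_prod prod_zero_iff)
    \<comment> \<open>The Lagrange interpolant of \<open>g\<close> at the roots of \<open>f\<close>:
      \<open>F z\<close> divided by the derivative of \<open>f\<close> at \<open>z\<close> is 1 at
      \<open>z\<close> and 0 at every other root. Both \<open>g\<close> and \<open>G\<close> have
      degree below \<open>card Z\<close>.\<close>
    define G where "G = (\<Sum>z\<in>Z. smult (poly g z / poly (pderiv f) z) (F z))"
    have "g = G"
    \<comment> \<open>Without roots the strict degree comparison with \<open>card Z = 0\<close>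
      fails, but then \<open>f\<close> is constant and \<open>g\<close> must be 0.\<close>
    proof (cases "Z = {}")
      case True
      then have "degree f = 0" using deg_f by simp
      then show ?thesis using less.prems(2) True by (simp add: G_def)
    next
      case False
      then have "card Z > 0" using \<open>finite Z\<close> by (simp add: card_gt_0_iff)
      show ?thesis
      proof (rule poly_eqI_degree)
        fix w assume w: "w \<in> Z"
        have "poly G w = (\<Sum>z\<in>Z. if z = w then poly g w else 0)"
          unfolding G_def poly_sum
        proof (rule sum.cong[OF refl])
          fix z assume "z \<in> Z"
          show "poly (smult (poly g z / poly (pderiv f) z) (F z)) w =
              (if z = w then poly g w else 0)"
            using w F_other[of w z] F_pderiv[of w] root Z_real[of w] by (auto simp: Z_def)
        qed
        then show "poly g w = poly G w" using w \<open>finite Z\<close> by simp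
      next
        show "card Z > degree g" using less.prems(2) deg_f \<open>card Z > 0\<close> by auto
        have "degree (F z) < card Z" if "z \<in> Z" for z
          using that \<open>finite Z\<close> \<open>card Z > 0\<close> lc by (simp add: F_def degree_prod_sum_eq)
        then have "degree (smult b (F z)) < card Z" if "z \<in> Z" for z b
          using that degree_smult_le le_less_trans by blast
        then show "card Z > degree G"
          unfolding G_def using \<open>card Z > 0\<close> by (intro degree_sum_less)
      qed
    qed
    define A where "A = {r :: real. of_real r \<in> Z}"
    have Z_A: "Z = of_real ` A" using Z_real by (auto simp: A_def)
    have inj: "inj_on complex_of_real A" by (simp add: inj_on_def)
    have "finite A" using \<open>finite Z\<close> Z_A inj by (simp add: finite_image_iff)
    obtain c where c: "\<And>r. r \<in> A \<Longrightarrow> c r \<ge> 0 \<and>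
        poly g (of_real r) / poly (pderiv f) (of_real r) = of_real (c r)"
      using root unfolding A_def Z_def mem_Collect_eq by metis
    have "poly g s / poly f s = (\<Sum>a\<in>A. of_real (c a) / (s - of_real a))" if s: "poly f s \<noteq> 0" for s
    proof -
      have "poly g s / poly f s =
          (\<Sum>z\<in>Z. poly g z / poly (pderiv f) z * (poly (F z) s / poly f s))"
        unfolding \<open>g = G\<close>[THEN arg_cong, of "\<lambda>p. poly p s"] G_def
        by (simp add: poly_sum sum_divide_distrib)
      also have "\<dots> = (\<Sum>z\<in>Z. poly g z / poly (pderiv f) z / (s - z))"
      proof (rule sum.cong[OF refl])
        fix z assume z: "z \<in> Z"
        have "poly f s = (s - z) * poly (F z) s"
          by (subst f_F[OF z]) (simp add: algebra_simps)
        with s show "poly g z / poly (pderiv f) z * (poly (F z) s / poly f s) =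
            poly g z / poly (pderiv f) z / (s - z)" by simp
      qed
      also have "\<dots> = (\<Sum>a\<in>A. of_real (c a) / (s - of_real a))"
        unfolding Z_A sum.reindex[OF inj] o_def using c by (intro sum.cong) simp_all
      finally show ?thesis .
    qed
    moreover have "\<forall>a\<in>A. c a \<ge> 0 \<and> poly f (of_real a) = 0" using c by (simp add: A_def Z_def)
    ultimately show ?thesis using \<open>finite A\<close> by blast
  qed
qed

section \<open>Partial derivatives and restriction to lines\<close>

abbreviation monomial_at :: "'a::comm_semiring_1 ^ 'n::finite \<Rightarrow> ('n \<Rightarrow>\<^sub>0 nat) \<Rightarrow> 'a" where
  "monomial_at x m \<equiv> (\<Prod>j\<in>UNIV. (x $ j) ^ Poly_Mapping.lookup m j)"

text \<open>The formal derivative, generic like \<open>eval_rpoly\<close> so that real and complex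
  points share one formula. At exponent 0 the truncated \<open>0 - 1\<close> is harmless because the
  factor in front is 0.\<close>

definition partial_deriv :: "'n::finite rpoly \<Rightarrow> 'n \<Rightarrow> 'a::real_normed_field ^ 'n \<Rightarrow> 'a" where
  "partial_deriv p i x =
     (\<Sum>m\<in>Poly_Mapping.keys p. of_real (Poly_Mapping.lookup p m) *
        (of_nat (Poly_Mapping.lookup m i) * (x $ i) ^ (Poly_Mapping.lookup m i - 1) *
         (\<Prod>j\<in>UNIV - {i}. (x $ j) ^ Poly_Mapping.lookup m j)))"

text \<open>The Euler operator: multiplying by the variable restores the exponent lowered by
  differentiation. This is what turns means into weighted averages of exponents.\<close>

lemma times_partial_deriv:
  "x $ i * partial_deriv p i x =
     (\<Sum>m\<in>Poly_Mapping.keys p. of_real (Poly_Mapping.lookup p m) *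
        (of_nat (Poly_Mapping.lookup m i) * monomial_at x m))"
  unfolding partial_deriv_def sum_distrib_left
proof (rule sum.cong[OF refl])
  fix m
  have "monomial_at x m = (x $ i) ^ Poly_Mapping.lookup m i *
      (\<Prod>j\<in>UNIV - {i}. (x $ j) ^ Poly_Mapping.lookup m j)"
    by (rule prod.remove) auto
  moreover have "x $ i * (c * (of_nat k * (x $ i) ^ (k - 1) * P)) = c * (of_nat k * ((x $ i) ^ k * P))"
    for c P and k :: nat by (cases k) (simp_all add: mult_ac)
  ultimately show "x $ i * (of_real (Poly_Mapping.lookup p m) *
        (of_nat (Poly_Mapping.lookup m i) * (x $ i) ^ (Poly_Mapping.lookup m i - 1) *
         (\<Prod>j\<in>UNIV - {i}. (x $ j) ^ Poly_Mapping.lookup m j))) =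
      of_real (Poly_Mapping.lookup p m) * (of_nat (Poly_Mapping.lookup m i) * monomial_at x m)"
    by (simp only:)
qed

lemma gradient_eval_rpoly:
  fixes x :: "real ^ 'n::finite"
  shows "gradient (eval_rpoly p) x $ i = partial_deriv p i x"
proof -
  have coord: "((\<lambda>y :: real ^ 'n. y $ j) has_derivative (\<lambda>h. h $ j)) (at x)" for j
    by (rule bounded_linear.has_derivative[OF bounded_linear_vec_nth has_derivative_ident])
  have "(eval_rpoly p has_derivative (\<lambda>h. \<Sum>m\<in>Poly_Mapping.keys p. of_real (Poly_Mapping.lookup p m) *
      (\<Sum>j\<in>UNIV. (of_nat (Poly_Mapping.lookup m j) * h $ j * (x $ j) ^ (Poly_Mapping.lookup m j - 1)) *
         (\<Prod>k\<in>UNIV - {j}. (x $ k) ^ Poly_Mapping.lookup m k)))) (at x)"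
    unfolding eval_rpoly_def
    by (intro has_derivative_sum has_derivative_mult_right has_derivative_prod
        has_derivative_power coord)
  also have "(\<lambda>h. \<Sum>m\<in>Poly_Mapping.keys p. of_real (Poly_Mapping.lookup p m) *
      (\<Sum>j\<in>UNIV. (of_nat (Poly_Mapping.lookup m j) * h $ j * (x $ j) ^ (Poly_Mapping.lookup m j - 1)) *
         (\<Prod>k\<in>UNIV - {j}. (x $ k) ^ Poly_Mapping.lookup m k))) =
      (\<lambda>h. inner h (\<chi> j. partial_deriv p j x))"
  proof
    fix h
    show "(\<Sum>m\<in>Poly_Mapping.keys p. of_real (Poly_Mapping.lookup p m) *
      (\<Sum>j\<in>UNIV. (of_nat (Poly_Mapping.lookup m j) * h $ j * (x $ j) ^ (Poly_Mapping.lookup m j - 1)) *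
         (\<Prod>k\<in>UNIV - {j}. (x $ k) ^ Poly_Mapping.lookup m k))) = inner h (\<chi> j. partial_deriv p j x)"
      unfolding inner_vec_def partial_deriv_def sum_distrib_left vec_lambda_beta inner_real_def
      by (subst sum.swap, intro sum.cong refl) (simp only: mult_ac)
  qed
  finally have "GDERIV (eval_rpoly p) x :> (\<chi> j. partial_deriv p j x)"
    unfolding gderiv_def .
  then show ?thesis by (simp add: gradient_eqI)
qed

lemma eval_rpoly_of_real:
  fixes x :: "real ^ 'n::finite"
  shows   "eval_rpoly p (\<chi> j. (of_real (x $ j) :: 'a::real_normed_field)) = of_real (eval_rpoly p x)"
  by (simp add: eval_rpoly_def)

lemma partial_deriv_of_real:
  fixes x :: "real ^ 'n::finite"
  shows   "partial_deriv p i (\<chi> j. (of_real (x $ j) :: 'a::real_normed_field)) = of_real (partial_deriv p i x)"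
  by (simp add: partial_deriv_def)

lemma eval_rpoly_cnj: "eval_rpoly p (\<chi> j. cnj (z $ j)) = cnj (eval_rpoly p z)"
  by (simp add: eval_rpoly_def)

lemma pderiv_sum: "pderiv (\<Sum>x\<in>A. f x) = (\<Sum>x\<in>A. pderiv (f x))"
  by (induction A rule: infinite_finite_induct) (simp_all add: pderiv_add)

text \<open>Moving only coordinate \<open>i\<close> by \<open>w\<close> gives a univariate
  polynomial \<open>P\<close> whose logarithmic derivative at 0 is the quotient. A root with
  \<open>Im w \<ge> 0\<close> would leave all coordinates in the open upper half plane, against
  stability, so \<open>Im_logderiv_nonpos\<close> applies.\<close>

lemma Im_partial_deriv_div_nonpos:
  assumes "real_stable p" and z: "\<And>j. Im (z $ j) > 0"
  shows "Im (partial_deriv p i z / eval_rpoly p z) \<le> 0"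
proof -
  define b where "b m = of_real (Poly_Mapping.lookup p m) *
      (\<Prod>j\<in>UNIV - {i}. (z $ j) ^ Poly_Mapping.lookup m j)" for m
  define P where "P = (\<Sum>m\<in>Poly_Mapping.keys p. smult (b m) ([:z $ i, 1:] ^ Poly_Mapping.lookup m i))"
  have P: "poly P w = eval_rpoly p (\<chi> j. if j = i then z $ i + w else z $ j)" for w
    unfolding P_def eval_rpoly_def poly_sum
  proof (rule sum.cong[OF refl])
    fix m
    have "monomial_at (\<chi> j. if j = i then z $ i + w else z $ j) m =
        (z $ i + w) ^ Poly_Mapping.lookup m i * (\<Prod>j\<in>UNIV - {i}. (z $ j) ^ Poly_Mapping.lookup m j)"
      by (subst prod.remove[of _ i]) auto
    then show "poly (smult (b m) ([:z $ i, 1:] ^ Poly_Mapping.lookup m i)) w =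
        of_real (Poly_Mapping.lookup p m) * monomial_at (\<chi> j. if j = i then z $ i + w else z $ j) m"
      by (simp add: b_def)
  qed
  have P0: "poly P 0 = eval_rpoly p z"
    unfolding P by (rule arg_cong[where f = "eval_rpoly p"]) (simp add: vec_eq_iff)
  have dP: "poly (pderiv P) 0 = partial_deriv p i z"
  proof -
    have "poly (pderiv P) 0 = (\<Sum>m\<in>Poly_Mapping.keys p.
        poly (pderiv (smult (b m) ([:z $ i, 1:] ^ Poly_Mapping.lookup m i))) 0)"
      unfolding P_def pderiv_sum poly_sum ..
    also have "\<dots> = partial_deriv p i z"
      unfolding partial_deriv_def
      by (intro sum.cong refl) (simp add: pderiv_smult pderiv_power pderiv_pCons b_def)
    finally show ?thesis .
  qed
  have "Im w < 0" if "poly P w = 0" for w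
  proof (rule ccontr)
    assume "\<not> Im w < 0"
    then have "\<forall>j. Im ((\<chi> j. if j = i then z $ i + w else z $ j) $ j) > 0"
      using z by (simp add: add_pos_nonneg)
    then show False using assms(1) that unfolding P real_stable_def by blast
  qed
  then show ?thesis using Im_logderiv_nonpos[of P] P0 dP by simp
qed

text \<open>The coefficients are complex although \<open>x\<close> and \<open>v\<close> are real,
  because the partial fraction lemma evaluates the restriction in the upper half plane.\<close>

definition line_poly :: "'n::finite rpoly \<Rightarrow> real ^ 'n \<Rightarrow> real ^ 'n \<Rightarrow> complex poly" where
  "line_poly p x v = (\<Sum>m\<in>Poly_Mapping.keys p. smult (of_real (Poly_Mapping.lookup p m))
     (\<Prod>j\<in>UNIV. [:of_real (x $ j), of_real (v $ j):] ^ Poly_Mapping.lookup m j))"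

text \<open>The restriction to the line of one partial derivative, not the derivative of
  \<open>line_poly\<close>, which would mix all partial derivatives with weights
  \<open>v\<close>.\<close>

definition line_partial :: "'n::finite rpoly \<Rightarrow> 'n \<Rightarrow> real ^ 'n \<Rightarrow> real ^ 'n \<Rightarrow> complex poly" where
  "line_partial p i x v = (\<Sum>m\<in>Poly_Mapping.keys p. smult (of_real (Poly_Mapping.lookup p m))
     (smult (of_nat (Poly_Mapping.lookup m i))
       ([:of_real (x $ i), of_real (v $ i):] ^ (Poly_Mapping.lookup m i - 1) *
        (\<Prod>j\<in>UNIV - {i}. [:of_real (x $ j), of_real (v $ j):] ^ Poly_Mapping.lookup m j))))"

lemma poly_line_poly:
  "poly (line_poly p x v) s = eval_rpoly p (\<chi> j. of_real (x $ j) + s * of_real (v $ j))"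
  by (simp add: line_poly_def eval_rpoly_def poly_sum poly_prod)

lemma poly_line_partial:
  "poly (line_partial p i x v) s = partial_deriv p i (\<chi> j. of_real (x $ j) + s * of_real (v $ j))"
  by (simp add: line_partial_def partial_deriv_def poly_sum poly_prod mult_ac)

lemma poly_line_poly_of_real: "poly (line_poly p x v) (of_real s) = of_real (eval_rpoly p (x + s *\<^sub>R v))"
  using eval_rpoly_of_real[where 'a = complex, of p "x + s *\<^sub>R v"] by (simp add: poly_line_poly)

lemma poly_line_partial_of_real:
  "poly (line_partial p i x v) (of_real s) = of_real (partial_deriv p i (x + s *\<^sub>R v))"
  using partial_deriv_of_real[where 'a = complex, of p i "x + s *\<^sub>R v"] by (simp add: poly_line_partial)

text \<open>Convexity of \<open>n \<mapsto> t ^ n\<close> over the integers: after division by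
  \<open>t ^ k\<close>, the chords from \<open>k\<close> to \<open>k - 1\<close> and to
  \<open>k + 1\<close> have slopes \<open>1 - 1 / t\<close> and \<open>t - 1\<close>, and every
  slope between them supports. The two sides of \<open>k\<close> are Bernoulli's inequality for the
  bases \<open>t\<close> and \<open>1 / t\<close>.\<close>

lemma power_ge_support_line:
  fixes t s :: real and k n :: nat
  assumes t: "t > 0" and s: "1 - 1 / t \<le> s" "s \<le> t - 1"
  shows "t ^ k * (1 + (real n - real k) * s) \<le> t ^ n"
proof (cases "k \<le> n")
  case True
  have "1 + real (n - k) * s \<le> 1 + real (n - k) * (t - 1)"
    using s by (intro add_left_mono mult_left_mono) auto
  also have "\<dots> \<le> t ^ (n - k)"
    using Bernoulli_inequality[of "t - 1" "n - k"] t by simp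
  finally have "t ^ k * (1 + real (n - k) * s) \<le> t ^ k * t ^ (n - k)"
    using t by (intro mult_left_mono) auto
  then show ?thesis using True by (simp add: of_nat_diff flip: power_add)
next
  case False
  then have kn: "n \<le> k" by simp
  have "1 + real (k - n) * (- s) \<le> 1 + real (k - n) * (1 / t - 1)"
    using s by (intro add_left_mono mult_left_mono) auto
  also have "\<dots> \<le> (1 / t) ^ (k - n)"
    using Bernoulli_inequality[of "1 / t - 1" "k - n"] t by simp
  finally have "t ^ k * (1 + real (k - n) * (- s)) \<le> t ^ k * (1 / t) ^ (k - n)"
    using t by (intro mult_left_mono) auto
  also have "t ^ k * (1 / t) ^ (k - n) = t ^ n"
    using t kn by (simp add: power_one_over power_diff field_simps)
  finally show ?thesis using kn by (simp add: of_nat_diff algebra_simps)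
qed

section \<open>Means and the capacity bound\<close>

locale nonneg_stable =
  fixes p :: "'n::finite rpoly"
  assumes nonneg: "nonneg_coeffs p" and stable: "real_stable p" and nonzero: "p \<noteq> 0"
begin

section \<open>Positivity, degrees and partial fractions along positive lines\<close>

lemma coeff_pos: "Poly_Mapping.lookup p m > 0" if "m \<in> Poly_Mapping.keys p" for m
  using nonneg that unfolding nonneg_coeffs_def by (simp add: in_keys_iff order_less_le)

lemma keys_nonempty: "Poly_Mapping.keys p \<noteq> {}"
  using nonzero by simp

lemma eval_pos:
  fixes x :: "real ^ 'n"
  assumes "\<And>j. x $ j > 0"
  shows "eval_rpoly p x > 0"
  unfolding eval_rpoly_def of_real_eq_id id_apply
  using keys_nonempty
  by (intro sum_pos mult_pos_pos prod_pos zero_less_power coeff_pos assms ballI) simp_all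

text \<open>Nothing cancels at the top: with \<open>D\<close> the largest total degree in
  \<open>p\<close>, the coefficient at \<open>D\<close> is a sum of positive numbers, as
  coefficients and direction are positive. Each nonzero term of the partial derivative has lost one
  linear factor.\<close>

lemma line_degree:
  assumes v: "\<And>j. v $ j > 0"
  shows "line_poly p x v \<noteq> 0" and
    "line_partial p i x v = 0 \<or> degree (line_partial p i x v) < degree (line_poly p x v)"
proof -
  define L where "L j = [:of_real (x $ j), of_real (v $ j) :: complex:]" for j
  have deg_L: "degree (L j) = 1" and L0: "L j \<noteq> 0" and lc_L: "lead_coeff (L j) = of_real (v $ j)" for j
    using v[of j] by (auto simp: L_def)
  define d where "d m = (\<Sum>j\<in>UNIV. Poly_Mapping.lookup m j)" for m :: "'n \<Rightarrow>\<^sub>0 nat"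
  define D where "D = Max (d ` Poly_Mapping.keys p)"
  have fin: "finite (d ` Poly_Mapping.keys p)" by simp
  have d_le: "d m \<le> D" if "m \<in> Poly_Mapping.keys p" for m
    unfolding D_def using that by (intro Max_ge fin) auto
  have "D \<in> d ` Poly_Mapping.keys p"
    unfolding D_def using keys_nonempty by (intro Max_in fin) simp
  then obtain m0 where m0: "m0 \<in> Poly_Mapping.keys p" "d m0 = D" by auto
  define T where "T m = (\<Prod>j\<in>UNIV. L j ^ Poly_Mapping.lookup m j)" for m
  have deg_T: "degree (T m) = d m" for m
    unfolding T_def d_def using L0 deg_L by (simp add: degree_prod_sum_eq degree_power_eq)
  have coeff_T: "coeff (T m) D = (if d m = D then of_real (\<Prod>j\<in>UNIV. (v $ j) ^ Poly_Mapping.lookup m j) else 0)"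
    if "m \<in> Poly_Mapping.keys p" for m
  proof (cases "d m = D")
    case True
    have "coeff (T m) D = lead_coeff (T m)" using deg_T True by simp
    also have "\<dots> = of_real (\<Prod>j\<in>UNIV. (v $ j) ^ Poly_Mapping.lookup m j)"
      by (simp only: T_def lead_coeff_prod lead_coeff_power lc_L of_real_prod of_real_power)
    finally show ?thesis using True by simp
  next
    case False
    then show ?thesis using d_le[OF that] deg_T by (simp add: coeff_eq_0)
  qed
  have line: "line_poly p x v = (\<Sum>m\<in>Poly_Mapping.keys p. smult (of_real (Poly_Mapping.lookup p m)) (T m))"
    by (simp add: line_poly_def T_def L_def)
  have "coeff (line_poly p x v) D = of_real (\<Sum>m\<in>Poly_Mapping.keys p. Poly_Mapping.lookup p m *
      (if d m = D then \<Prod>j\<in>UNIV. (v $ j) ^ Poly_Mapping.lookup m j else 0))"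
    unfolding line coeff_sum of_real_sum by (rule sum.cong) (auto simp: coeff_T)
  moreover have "(\<Sum>m\<in>Poly_Mapping.keys p. Poly_Mapping.lookup p m *
      (if d m = D then \<Prod>j\<in>UNIV. (v $ j) ^ Poly_Mapping.lookup m j else 0)) > 0"
  proof (rule sum_pos2[OF _ m0(1)])
    have pos: "monomial_at v m > 0" for m
      by (intro prod_pos ballI zero_less_power v)
    show "Poly_Mapping.lookup p m0 * (if d m0 = D then monomial_at v m0 else 0) > 0"
      using m0 coeff_pos pos by simp
    show "Poly_Mapping.lookup p m * (if d m = D then monomial_at v m else 0) \<ge> 0"
      if "m \<in> Poly_Mapping.keys p" for m
      using coeff_pos[OF that] pos[of m] by simp
  qed simp
  ultimately have cD: "coeff (line_poly p x v) D \<noteq> 0"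
    by (simp only: of_real_eq_0_iff less_imp_neq[THEN not_sym] not_False_eq_True)
  then show "line_poly p x v \<noteq> 0" by auto
  have "D \<le> degree (line_poly p x v)" using cD by (rule le_degree)
  moreover have "line_partial p i x v = 0 \<or> degree (line_partial p i x v) < D"
  proof (cases "D = 0")
    \<comment> \<open>Here \<open>p\<close> is constant, so the restricted derivative is the zero
      polynomial; no degree lies below 0.\<close>
    case True
    have "Poly_Mapping.lookup m i = 0" if "m \<in> Poly_Mapping.keys p" for m
      using d_le[OF that] True by (simp add: d_def)
    then show ?thesis by (simp add: line_partial_def)
  next
    case False
    define T' where "T' m = L i ^ (Poly_Mapping.lookup m i - 1) *
        (\<Prod>j\<in>UNIV - {i}. L j ^ Poly_Mapping.lookup m j)" for m
    have "degree (smult (of_real (Poly_Mapping.lookup p m)) (smult (of_nat (Poly_Mapping.lookup m i)) (T' m))) < D"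
      if m: "m \<in> Poly_Mapping.keys p" for m
    proof (cases "Poly_Mapping.lookup m i = 0")
      case True
      then show ?thesis using \<open>D \<noteq> 0\<close> by simp
    next
      case False
      have "L i * T' m = L i ^ Poly_Mapping.lookup m i * (\<Prod>j\<in>UNIV - {i}. L j ^ Poly_Mapping.lookup m j)"
        using False by (simp add: T'_def power_eq_if)
      also have "\<dots> = T m" unfolding T_def by (rule prod.remove[symmetric]) auto
      finally have LT: "L i * T' m = T m" .
      have "T' m \<noteq> 0" using L0 by (simp add: T'_def prod_zero_iff)
      then have "d m = Suc (degree (T' m))"
        using deg_T[of m] L0 deg_L by (simp add: degree_mult_eq flip: LT)
      then have "degree (T' m) < D" using d_le[OF m] by simp
      then show ?thesis by (meson degree_smult_le le_less_trans)
    qed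
    then have "degree (line_partial p i x v) < D"
      unfolding line_partial_def T'_def L_def using False by (intro degree_sum_less) auto
    then show ?thesis ..
  qed
  ultimately show "line_partial p i x v = 0 \<or> degree (line_partial p i x v) < degree (line_poly p x v)"
    by auto
qed

text \<open>A positive direction carries the upper half plane of \<open>s\<close> into the upper
  half plane of every coordinate, so stability together with conjugation makes all roots on the line
  real. They are at most 0 since \<open>p\<close> is positive on the positive orthant. Allowing
  \<open>x\<close> to have zero entries admits the ray through the origin.\<close>

lemma line_logderiv:
  assumes x: "\<And>j. x $ j \<ge> 0" and v: "\<And>j. v $ j > 0"
  shows "\<exists>A (c :: real \<Rightarrow> real). finite A \<and>
    (\<forall>a\<in>A. c a \<ge> 0 \<and> a \<le> 0 \<and> eval_rpoly p (x + a *\<^sub>R v) = 0) \<and>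
    (\<forall>s. eval_rpoly p (x + s *\<^sub>R v) \<noteq> 0 \<longrightarrow>
      partial_deriv p i (x + s *\<^sub>R v) / eval_rpoly p (x + s *\<^sub>R v) = (\<Sum>a\<in>A. c a / (s - a)))"
proof -
  have upper: "Im ((\<chi> j. of_real (x $ j) + s * of_real (v $ j)) $ j) > 0" if "Im s > 0" for s j
    using that v by simp
  have root: "s \<in> \<real>" if s: "poly (line_poly p x v) s = 0" for s
  proof (rule ccontr)
    assume "s \<notin> \<real>"
    then have "Im s > 0 \<or> Im (cnj s) > 0" by (auto simp: complex_is_Real_iff)
    moreover have "poly (line_poly p x v) (cnj s) = 0"
      using s eval_rpoly_cnj[of p "\<chi> j. of_real (x $ j) + s * of_real (v $ j)"]
      by (simp add: poly_line_poly)
    ultimately obtain s' where "Im s' > 0" "poly (line_poly p x v) s' = 0" using s by blast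
    then show False
      using stable[unfolded real_stable_def, rule_format, OF upper] by (simp only: poly_line_poly)
  qed
  have im: "Im (poly (line_partial p i x v) s / poly (line_poly p x v) s) \<le> 0" if "Im s > 0" for s
    unfolding poly_line_poly poly_line_partial
    by (rule Im_partial_deriv_div_nonpos[OF stable upper[OF that]])
  obtain A and c :: "real \<Rightarrow> real" where A: "finite A"
    "\<forall>a\<in>A. c a \<ge> 0 \<and> poly (line_poly p x v) (of_real a) = 0"
    and pf: "\<forall>s. poly (line_poly p x v) s \<noteq> 0 \<longrightarrow>
      poly (line_partial p i x v) s / poly (line_poly p x v) s = (\<Sum>a\<in>A. of_real (c a) / (s - of_real a))"
    using herglotz_partial_fractions[OF line_degree[OF v] root im] by blast
  show ?thesis
  proof (intro exI conjI ballI allI impI)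
    show "finite A" by (rule A(1))
  next
    fix a assume "a \<in> A"
    then have "c a \<ge> 0" and 0: "eval_rpoly p (x + a *\<^sub>R v) = 0"
      using A(2) by (simp_all add: poly_line_poly_of_real)
    moreover have "a \<le> 0"
    proof (rule ccontr)
      assume "\<not> a \<le> 0"
      then have "eval_rpoly p (x + a *\<^sub>R v) > 0"
        using x v by (intro eval_pos) (simp add: add_nonneg_pos)
      with 0 show False by simp
    qed
    ultimately show "c a \<ge> 0" "a \<le> 0" "eval_rpoly p (x + a *\<^sub>R v) = 0" by simp_all
  next
    fix s assume "eval_rpoly p (x + s *\<^sub>R v) \<noteq> 0"
    then have "of_real (partial_deriv p i (x + s *\<^sub>R v)) / of_real (eval_rpoly p (x + s *\<^sub>R v)) =
        (\<Sum>a\<in>A. of_real (c a) / (of_real s - of_real a) :: complex)"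
      using pf[rule_format, of "of_real s"]
      by (simp add: poly_line_poly_of_real poly_line_partial_of_real)
    then have "complex_of_real (partial_deriv p i (x + s *\<^sub>R v) / eval_rpoly p (x + s *\<^sub>R v)) =
        of_real (\<Sum>a\<in>A. c a / (s - a))" by simp
    then show "partial_deriv p i (x + s *\<^sub>R v) / eval_rpoly p (x + s *\<^sub>R v) = (\<Sum>a\<in>A. c a / (s - a))"
      by (simp only: of_real_eq_iff)
  qed
qed

section \<open>Monotonicity of the mean exponents under raising and scaling coordinates\<close>

definition mean :: "'n \<Rightarrow> real ^ 'n \<Rightarrow> real" where
  "mean i x = x $ i * partial_deriv p i x / eval_rpoly p x"

text \<open>Dividing by the coordinate leaves the quotient of partial derivative and polynomial. On
  the line from \<open>x\<close> to a strictly larger point it is a sum of terms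
  \<open>c / (s - a)\<close> with \<open>c \<ge> 0\<close> and \<open>a < 0\<close>, each decreasing
  for \<open>s \<ge> 0\<close>.\<close>

lemma mean_div_antimono:
  assumes x: "\<And>j. x $ j > 0" and xy: "\<And>j. x $ j \<le> y $ j"
  shows "mean i y / y $ i \<le> mean i x / x $ i"
proof -
  have y: "y $ j > 0" for j using x[of j] xy[of j] by simp
  have strict: "partial_deriv p i z / eval_rpoly p z \<le> partial_deriv p i x / eval_rpoly p x"
    if xz: "\<And>j. x $ j < z $ j" for z
  proof -
    have z: "z $ j > 0" for j using x[of j] xz[of j] by simp
    have line: "x $ j \<ge> 0" "(z - x) $ j > 0" for j
      using x[of j] xz[of j] by simp_all
    obtain A and c :: "real \<Rightarrow> real" where "finite A"
      and A: "\<And>a. a \<in> A \<Longrightarrow> c a \<ge> 0 \<and> a \<le> 0 \<and> eval_rpoly p (x + a *\<^sub>R (z - x)) = 0"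
      and pf: "\<And>s. eval_rpoly p (x + s *\<^sub>R (z - x)) \<noteq> 0 \<Longrightarrow>
        partial_deriv p i (x + s *\<^sub>R (z - x)) / eval_rpoly p (x + s *\<^sub>R (z - x)) = (\<Sum>a\<in>A. c a / (s - a))"
      using line_logderiv[of x "z - x" i, OF line] by blast
    have "partial_deriv p i z / eval_rpoly p z = (\<Sum>a\<in>A. c a / (1 - a))"
      using pf[of 1] eval_pos[OF z] by simp
    also have "\<dots> \<le> (\<Sum>a\<in>A. c a / (0 - a))"
    proof (rule sum_mono)
      fix a assume a: "a \<in> A"
      then have "a \<noteq> 0" using A[OF a] eval_pos[OF x] by auto
      then show "c a / (1 - a) \<le> c a / (0 - a)"
        using A[OF a] by (intro divide_left_mono) (auto simp: mult_less_0_iff)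
    qed
    also have "\<dots> = partial_deriv p i x / eval_rpoly p x"
      using pf[of 0] eval_pos[OF x] by simp
    finally show ?thesis .
  qed
  \<comment> \<open>\<open>line_logderiv\<close> needs a strictly positive direction, so
    \<open>y\<close> is pushed above \<open>x\<close> in every coordinate by \<open>e\<close>, which
    then tends to 0.\<close>
  define w where "w e = (\<chi> j. y $ j + e)" for e :: real
  have w: "((\<lambda>e. w e $ j) \<longlongrightarrow> w 0 $ j) (at_right 0)" for j
    unfolding w_def by (auto intro!: tendsto_eq_intros)
  have "eval_rpoly p (w 0) \<noteq> 0" using eval_pos[OF y] by (simp add: w_def)
  then have "((\<lambda>e. partial_deriv p i (w e) / eval_rpoly p (w e)) \<longlongrightarrow>
      partial_deriv p i (w 0) / eval_rpoly p (w 0)) (at_right 0)"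
    unfolding partial_deriv_def eval_rpoly_def by (intro tendsto_intros w)
  moreover have "\<forall>\<^sub>F e in at_right 0. partial_deriv p i (w e) / eval_rpoly p (w e) \<le>
      partial_deriv p i x / eval_rpoly p x"
    unfolding eventually_at_filter
    by (rule always_eventually) (auto simp: w_def intro!: strict le_less_trans[OF xy])
  ultimately have "partial_deriv p i (w 0) / eval_rpoly p (w 0) \<le> partial_deriv p i x / eval_rpoly p x"
    by (rule tendsto_upperbound) simp
  then show ?thesis
    using x[of i] y[of i] by (simp add: mean_def w_def)
qed

text \<open>On the ray through the origin the mean is a nonnegative combination of the functions
  \<open>s / (s - a)\<close> with \<open>a \<le> 0\<close>, and these do not decrease for
  \<open>s > 0\<close>.\<close>

lemma mean_scale_mono:
  assumes x: "\<And>j. x $ j > 0" and t: "t \<ge> 1"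
  shows "mean i x \<le> mean i (t *\<^sub>R x)"
proof -
  have "(0 :: real ^ 'n) $ j \<ge> 0" for j by simp
  then obtain A and c :: "real \<Rightarrow> real" where "finite A"
    and A: "\<And>a. a \<in> A \<Longrightarrow> c a \<ge> 0 \<and> a \<le> 0 \<and> eval_rpoly p (0 + a *\<^sub>R x) = 0"
    and pf: "\<And>s. eval_rpoly p (0 + s *\<^sub>R x) \<noteq> 0 \<Longrightarrow>
      partial_deriv p i (0 + s *\<^sub>R x) / eval_rpoly p (0 + s *\<^sub>R x) = (\<Sum>a\<in>A. c a / (s - a))"
    using line_logderiv[of 0 x i, OF _ x] by blast
  have pos: "eval_rpoly p (s *\<^sub>R x) > 0" if "s > 0" for s
    using that x by (intro eval_pos) simp
  have "mean i (s *\<^sub>R x) = x $ i * (\<Sum>a\<in>A. s * c a / (s - a))" if "s > 0" for s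
    using pf[of s] pos[OF that] that by (simp add: mean_def sum_distrib_left mult_ac flip: times_divide_eq_right)
  from this[of 1] this[of t] t
  have "mean i x = x $ i * (\<Sum>a\<in>A. 1 * c a / (1 - a))"
    "mean i (t *\<^sub>R x) = x $ i * (\<Sum>a\<in>A. t * c a / (t - a))" by simp_all
  moreover have "(\<Sum>a\<in>A. 1 * c a / (1 - a)) \<le> (\<Sum>a\<in>A. t * c a / (t - a))"
  proof (rule sum_mono)
    fix a assume a: "a \<in> A"
    then have "a \<le> 0" "c a \<ge> 0" using A by auto
    then have "t * a \<le> 1 * a" using t by (intro mult_right_mono_neg) auto
    then have "1 / (1 - a) \<le> t / (t - a)"
      using \<open>a \<le> 0\<close> t by (simp add: field_simps)
    then have "c a * (1 / (1 - a)) \<le> c a * (t / (t - a))"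
      using \<open>c a \<ge> 0\<close> by (rule mult_left_mono)
    then show "1 * c a / (1 - a) \<le> t * c a / (t - a)" by (simp add: mult.commute)
  qed
  ultimately show ?thesis using x[of i] by (simp add: mult_left_mono)
qed

text \<open>Scaling all coordinates does not lower the mean; returning the coordinates outside
  \<open>S\<close> to their smaller values keeps coordinate \<open>i\<close> fixed and can only
  raise it further.\<close>

lemma mean_scale_set_mono:
  assumes x: "\<And>j. x $ j > 0" and t: "t \<ge> 1" and i: "i \<in> S"
  shows "mean i x \<le> mean i (\<chi> j. if j \<in> S then t * x $ j else x $ j)"
proof -
  let ?y = "\<chi> j. if j \<in> S then t * x $ j else x $ j"
  have "?y $ j > 0" for j using x[of j] t by simp
  moreover have "?y $ j \<le> (t *\<^sub>R x) $ j" for j using x[of j] t by simp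
  ultimately have "mean i (t *\<^sub>R x) / (t *\<^sub>R x) $ i \<le> mean i ?y / ?y $ i"
    by (rule mean_div_antimono)
  then have "mean i (t *\<^sub>R x) \<le> mean i ?y"
    using i x[of i] t by (simp add: divide_le_cancel)
  with mean_scale_mono[OF x t] show ?thesis by (rule order_trans)
qed

lemma mean_antimono_coord:
  assumes x: "\<And>j. x $ j > 0" and xy: "\<And>j. x $ j \<le> y $ j" and i: "x $ i = y $ i"
  shows "mean i y \<le> mean i x"
  using mean_div_antimono[OF x xy, of i] i x[of i] by (simp add: divide_le_cancel)

text \<open>The slope \<open>s\<close> only needs to support \<open>n \<mapsto> t ^ n\<close> at integers, hence the choice
  between the slopes of the chords on either side of \<open>K\<close>.\<close>

lemma eval_scale_set_ge:
  fixes y :: "real ^ 'n"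
  assumes y: "\<And>j. y $ j > 0" and t: "t > 0" and s: "1 - 1 / t \<le> s" "s \<le> t - 1"
  shows "t ^ K * (1 + ((\<Sum>i\<in>S. mean i y) - real K) * s) * eval_rpoly p y
      \<le> eval_rpoly p (\<chi> j. if j \<in> S then t * y $ j else y $ j)"
proof -
  define d where "d m = (\<Sum>i\<in>S. Poly_Mapping.lookup m i)" for m :: "'n \<Rightarrow>\<^sub>0 nat"
  let ?q = "\<lambda>m. Poly_Mapping.lookup p m * monomial_at y m"
  have pos: "eval_rpoly p y > 0" using y by (rule eval_pos)
  have q_nonneg: "?q m \<ge> 0" if "m \<in> Poly_Mapping.keys p" for m
    using coeff_pos[OF that] y by (intro mult_nonneg_nonneg prod_nonneg zero_le_power ballI less_imp_le)
  have "(\<Sum>i\<in>S. mean i y) * eval_rpoly p y = (\<Sum>i\<in>S. y $ i * partial_deriv p i y)"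
    using pos by (simp add: mean_def sum_divide_distrib[symmetric])
  also have "\<dots> = (\<Sum>m\<in>Poly_Mapping.keys p. \<Sum>i\<in>S. real (Poly_Mapping.lookup m i) * ?q m)"
    unfolding times_partial_deriv of_real_eq_id id_apply
    by (subst sum.swap, intro sum.cong refl) (simp only: mult_ac)
  also have "\<dots> = (\<Sum>m\<in>Poly_Mapping.keys p. real (d m) * ?q m)"
    by (simp only: d_def of_nat_sum sum_distrib_right)
  finally have mean_eq: "(\<Sum>i\<in>S. mean i y) * eval_rpoly p y =
      (\<Sum>m\<in>Poly_Mapping.keys p. real (d m) * ?q m)" .
  have eval_eq: "eval_rpoly p y = (\<Sum>m\<in>Poly_Mapping.keys p. ?q m)"
    by (simp add: eval_rpoly_def)
  \<comment> \<open>The supporting line is affine in the exponent sum \<open>d m\<close>. Averaging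
    it with the weights of the monomials at \<open>y\<close> therefore involves only the sum of the
    means over \<open>S\<close>.\<close>
  have "t ^ K * (1 + ((\<Sum>i\<in>S. mean i y) - real K) * s) * eval_rpoly p y =
      t ^ K * (1 - real K * s) * eval_rpoly p y + t ^ K * s * ((\<Sum>i\<in>S. mean i y) * eval_rpoly p y)"
    by (simp add: algebra_simps)
  also have "\<dots> = (\<Sum>m\<in>Poly_Mapping.keys p. t ^ K * (1 - real K * s) * ?q m + t ^ K * s * (real (d m) * ?q m))"
    unfolding mean_eq unfolding eval_eq sum_distrib_left sum.distrib ..
  also have "\<dots> = (\<Sum>m\<in>Poly_Mapping.keys p. t ^ K * (1 + (real (d m) - real K) * s) * ?q m)"
    by (intro sum.cong refl) (simp only: algebra_simps)
  also have "\<dots> \<le> (\<Sum>m\<in>Poly_Mapping.keys p. t ^ d m * ?q m)"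
    by (intro sum_mono mult_right_mono power_ge_support_line t s q_nonneg)
  also have "\<dots> = eval_rpoly p (\<chi> j. if j \<in> S then t * y $ j else y $ j)"
    unfolding eval_rpoly_def
  proof (rule sum.cong[OF refl])
    fix m
    have "monomial_at (\<chi> j. if j \<in> S then t * y $ j else y $ j) m =
        (\<Prod>j\<in>UNIV. (if j \<in> S then t ^ Poly_Mapping.lookup m j else 1) * (y $ j) ^ Poly_Mapping.lookup m j)"
      by (rule prod.cong) (auto simp: power_mult_distrib)
    also have "\<dots> = (\<Prod>j\<in>S. t ^ Poly_Mapping.lookup m j) * monomial_at y m"
      by (simp add: prod.distrib prod.If_cases)
    also have "(\<Prod>j\<in>S. t ^ Poly_Mapping.lookup m j) = t ^ d m"
      by (simp add: d_def power_sum)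
    finally show "t ^ d m * ?q m = of_real (Poly_Mapping.lookup p m) *
        monomial_at (\<chi> j. if j \<in> S then t * y $ j else y $ j) m" by simp
  qed
  finally show ?thesis .
qed

text \<open>With a slope \<open>s\<close> satisfying \<open>0 \<le> \<sigma> * s \<le> 1\<close>,
  the supporting line loses at most \<delta>, and only the sign of the defect selected by \<sigma>
  can cause a loss.\<close>

lemma eval_scale_set_ge_defect:
  fixes y :: "real ^ 'n"
  assumes y: "\<And>j. y $ j > 0" and t: "t > 0" and \<sigma>: "\<sigma> = 1 \<or> \<sigma> = - 1" "\<sigma> * (t - 1) \<ge> 0"
    and K: "\<sigma> * (real K - (\<Sum>i\<in>S. mean i y)) \<le> \<delta>" and \<delta>: "\<delta> \<ge> 0"
  shows "(1 - \<delta>) * t ^ K * eval_rpoly p y \<le> eval_rpoly p (\<chi> j. if j \<in> S then t * y $ j else y $ j)"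
proof -
  let ?M = "\<Sum>i\<in>S. mean i y"
  \<comment> \<open>The end of the admissible interval nearest to 0 is taken:
    \<open>1 - 1 / t\<close> when \<open>t \<ge> 1\<close>, and \<open>t - 1\<close> when
    \<open>t \<le> 1\<close>.\<close>
  obtain s where s: "1 - 1 / t \<le> s" "s \<le> t - 1" "0 \<le> \<sigma> * s" "\<sigma> * s \<le> 1"
  proof -
    have "1 / t + t \<ge> 2"
      using t sum_squares_bound[of 1 t] by (simp add: field_simps power2_eq_square)
    then have mid: "1 - 1 / t \<le> t - 1" by simp
    show thesis
    proof (cases "\<sigma> = 1")
      case True
      then show ?thesis using that[of "1 - 1 / t"] mid \<sigma> t by simp
    next
      case False
      then show ?thesis using that[of "t - 1"] mid \<sigma> t by simp
    qed
  qed
  have "\<sigma> * \<sigma> = 1" using \<sigma> by auto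
  then have "(real K - ?M) * s = \<sigma> * (real K - ?M) * (\<sigma> * s)"
    by (simp only: mult_ac) (simp flip: mult.assoc)
  also have "\<dots> \<le> \<delta> * (\<sigma> * s)" using K s by (intro mult_right_mono)
  also have "\<dots> \<le> \<delta> * 1" using s \<delta> by (intro mult_left_mono)
  finally have "1 - \<delta> \<le> 1 + (?M - real K) * s" by (simp add: algebra_simps)
  then have "(1 - \<delta>) * (t ^ K * eval_rpoly p y) \<le> (1 + (?M - real K) * s) * (t ^ K * eval_rpoly p y)"
    using t eval_pos[OF y] by (intro mult_right_mono) auto
  also have "\<dots> = t ^ K * (1 + (?M - real K) * s) * eval_rpoly p y" by simp
  also have "\<dots> \<le> eval_rpoly p (\<chi> j. if j \<in> S then t * y $ j else y $ j)"
    by (rule eval_scale_set_ge[OF y t s(1,2)])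
  finally show ?thesis by simp
qed

lemma mean_scale_set:
  assumes y: "\<And>j. y $ j > 0" and t: "t > 0" and \<sigma>: "\<sigma> = 1 \<or> \<sigma> = - 1" "\<sigma> * (t - 1) \<ge> 0"
    and i: "i \<in> S"
  shows "\<sigma> * mean i y \<le> \<sigma> * mean i (\<chi> j. if j \<in> S then t * y $ j else y $ j)"
proof (cases "\<sigma> = 1")
  case True
  then show ?thesis using mean_scale_set_mono[OF y _ i, of t] \<sigma> by simp
next
  case False
  then have t1: "t \<le> 1" "\<sigma> = - 1" using \<sigma> by auto
  let ?z = "\<chi> j. if j \<in> S then t * y $ j else y $ j"
  \<comment> \<open>The shrinking is undone: scaling the shrunk point up by
    \<open>1 / t \<ge> 1\<close> on \<open>S\<close> recovers \<open>y\<close>.\<close>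
  have "mean i ?z \<le> mean i (\<chi> j. if j \<in> S then 1 / t * ?z $ j else ?z $ j)"
    using y t t1 i by (intro mean_scale_set_mono) simp_all
  also have "(\<chi> j. if j \<in> S then 1 / t * ?z $ j else ?z $ j) = y"
    using t by (simp add: vec_eq_iff)
  finally show ?thesis using t1 by simp
qed

text \<open>Scaling all of \<open>S\<close> by the factor closest to 1 settles one coordinate, and it moves the
  means of the others in the favourable direction. The sign \<open>\<sigma>\<close> tells whether coordinates
  are increased or decreased.\<close>

lemma eval_scale_coords_ge:
  fixes y :: "real ^ 'n" and \<kappa> :: "'n \<Rightarrow> nat"
  assumes "\<And>j. y $ j > 0" and "\<And>i. i \<in> S \<Longrightarrow> \<tau> i > 0 \<and> \<sigma> * (\<tau> i - 1) \<ge> 0"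
    and "\<And>R. R \<subseteq> S \<Longrightarrow> \<sigma> * ((\<Sum>i\<in>R. real (\<kappa> i)) - (\<Sum>i\<in>R. mean i y)) \<le> \<delta>"
    and \<sigma>: "\<sigma> = 1 \<or> \<sigma> = - 1" and \<delta>: "0 \<le> \<delta>" "\<delta> \<le> 1"
  shows "(1 - \<delta>) ^ card S * (\<Prod>i\<in>S. \<tau> i ^ \<kappa> i) * eval_rpoly p y
      \<le> eval_rpoly p (\<chi> j. if j \<in> S then \<tau> j * y $ j else y $ j)"
  using assms(1-3)
proof (induction "card S" arbitrary: S \<tau> y)
  case 0
  then have "S = {}" by simp
  then show ?case by simp
next
  case (Suc n)
  then have "S \<noteq> {}" by auto
  \<comment> \<open>The minimum of \<open>\<sigma> * \<tau> i\<close> selects the smallest factor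
    when increasing and the largest when decreasing, in both cases the one closest to 1.\<close>
  then have "Min ((\<lambda>i. \<sigma> * \<tau> i) ` S) \<in> (\<lambda>i. \<sigma> * \<tau> i) ` S" by (intro Min_in) auto
  then obtain a where a: "a \<in> S" and Min: "\<sigma> * \<tau> a = Min ((\<lambda>i. \<sigma> * \<tau> i) ` S)" by auto
  define t where "t = \<tau> a"
  have t_le: "\<sigma> * t \<le> \<sigma> * \<tau> i" if "i \<in> S" for i
    unfolding t_def Min using that by (intro Min_le) auto
  have t: "t > 0" "\<sigma> * (t - 1) \<ge> 0" using Suc.prems(2) a by (auto simp: t_def)
  define y' where "y' = (\<chi> j. if j \<in> S then t * y $ j else y $ j)"
  define K where "K = (\<Sum>i\<in>S. \<kappa> i)"
  have y': "y' $ j > 0" for j using Suc.prems(1)[of j] t by (simp add: y'_def)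
  have mean: "\<sigma> * mean i y \<le> \<sigma> * mean i y'" if "i \<in> S" for i
    unfolding y'_def by (rule mean_scale_set[OF Suc.prems(1) t(1) \<sigma> t(2) that])
  have step: "(1 - \<delta>) * t ^ K * eval_rpoly p y \<le> eval_rpoly p y'"
    unfolding y'_def using Suc.prems(3)[of S]
    by (intro eval_scale_set_ge_defect[OF Suc.prems(1) t(1) \<sigma> t(2) _ \<delta>(1)]) (simp add: K_def)
  \<comment> \<open>After scaling \<open>S\<close> by \<open>t\<close>, coordinate \<open>a\<close>
    is final and the others still need the factors \<open>\<tau> i / t\<close>, which stay on the
    same side of 1 by the choice of \<open>a\<close>.\<close>
  have IH: "(1 - \<delta>) ^ card (S - {a}) * (\<Prod>i\<in>S - {a}. (\<tau> i / t) ^ \<kappa> i) * eval_rpoly p y'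
      \<le> eval_rpoly p (\<chi> j. if j \<in> S - {a} then \<tau> j / t * y' $ j else y' $ j)"
  proof (rule Suc.hyps(1))
    show "n = card (S - {a})" using Suc.hyps(2) a by simp
    show "y' $ j > 0" for j by (rule y')
    show "\<tau> i / t > 0 \<and> \<sigma> * (\<tau> i / t - 1) \<ge> 0" if "i \<in> S - {a}" for i
    proof -
      have "\<sigma> * (\<tau> i / t - 1) = (\<sigma> * \<tau> i - \<sigma> * t) / t" using t by (simp add: field_simps)
      then show ?thesis using t_le[of i] t Suc.prems(2)[of i] that by simp
    qed
    \<comment> \<open>The defect bound survives for every remaining subset because the means over it
      have moved in the direction of \<sigma>.\<close>
    show "\<sigma> * ((\<Sum>i\<in>R. real (\<kappa> i)) - (\<Sum>i\<in>R. mean i y')) \<le> \<delta>" if "R \<subseteq> S - {a}" for R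
    proof -
      have "\<sigma> * (\<Sum>i\<in>R. mean i y) \<le> \<sigma> * (\<Sum>i\<in>R. mean i y')"
        unfolding sum_distrib_left using that by (intro sum_mono mean) auto
      moreover have "\<sigma> * ((\<Sum>i\<in>R. real (\<kappa> i)) - (\<Sum>i\<in>R. mean i y)) \<le> \<delta>"
        using that by (intro Suc.prems(3)) auto
      ultimately show ?thesis by (simp add: right_diff_distrib)
    qed
  qed
  have card: "card S = Suc (card (S - {a}))" using Suc.hyps(2) a by simp
  have "(\<Prod>i\<in>S. \<tau> i ^ \<kappa> i) = (\<Prod>i\<in>S. t ^ \<kappa> i * (\<tau> i / t) ^ \<kappa> i)"
    using t by (intro prod.cong) (auto simp flip: power_mult_distrib)
  also have "\<dots> = t ^ K * (\<Prod>i\<in>S. (\<tau> i / t) ^ \<kappa> i)"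
    by (simp add: prod.distrib power_sum K_def)
  \<comment> \<open>The factor at \<open>a\<close> is 1 since \<open>\<tau> a = t\<close>.\<close>
  also have "(\<Prod>i\<in>S. (\<tau> i / t) ^ \<kappa> i) = (\<Prod>i\<in>S - {a}. (\<tau> i / t) ^ \<kappa> i)"
    using t by (subst prod.remove[OF _ a]) (simp_all flip: t_def)
  finally have "(1 - \<delta>) ^ card S * (\<Prod>i\<in>S. \<tau> i ^ \<kappa> i) * eval_rpoly p y =
      ((1 - \<delta>) ^ card (S - {a}) * (\<Prod>i\<in>S - {a}. (\<tau> i / t) ^ \<kappa> i)) * ((1 - \<delta>) * t ^ K * eval_rpoly p y)"
    by (simp add: card mult_ac)
  also have "\<dots> \<le> ((1 - \<delta>) ^ card (S - {a}) * (\<Prod>i\<in>S - {a}. (\<tau> i / t) ^ \<kappa> i)) * eval_rpoly p y'"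
  proof (intro mult_left_mono step mult_nonneg_nonneg prod_nonneg zero_le_power ballI)
    show "1 - \<delta> \<ge> 0" using \<delta> by simp
    show "\<tau> i / t \<ge> 0" if "i \<in> S - {a}" for i using Suc.prems(2)[of i] t that by simp
  qed
  also note IH
  also have "(\<chi> j. if j \<in> S - {a} then \<tau> j / t * y' $ j else y' $ j) =
      (\<chi> j. if j \<in> S then \<tau> j * y $ j else y $ j)"
    using t by (auto simp: vec_eq_iff y'_def t_def)
  finally show ?case .
qed

lemma eval_ge_prod_power:
  fixes x :: "real ^ 'n" and \<kappa> :: "'n \<Rightarrow> nat"
  assumes x: "\<And>j. x $ j > 0" and p1: "eval_rpoly p (1 :: real ^ 'n) = 1"
    and \<delta>: "(\<Sum>i\<in>UNIV. \<bar>real (\<kappa> i) - partial_deriv p i (1 :: real ^ 'n)\<bar>) = \<delta>" "\<delta> \<le> 1"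
  shows "(1 - \<delta>) ^ CARD('n) * (\<Prod>i\<in>UNIV. (x $ i) ^ \<kappa> i) \<le> eval_rpoly p x"
proof -
  define U where "U = {j. x $ j > 1}"
  define z where "z = (\<chi> j. if j \<in> U then x $ j else 1)"
  have \<delta>0: "\<delta> \<ge> 0" using \<delta>(1) by (auto intro: sum_nonneg)
  have mean1: "mean i 1 = partial_deriv p i 1" for i using p1 by (simp add: mean_def)
  \<comment> \<open>By the triangle inequality the l1 distance bounds the defect of every subset at
    the all-ones vector, with either sign. Hence one \<delta> serves the upward and the downward
    phase.\<close>
  have abs: "\<bar>(\<Sum>i\<in>R. real (\<kappa> i)) - (\<Sum>i\<in>R. mean i 1)\<bar> \<le> \<delta>" for R
  proof -
    have "\<bar>(\<Sum>i\<in>R. real (\<kappa> i)) - (\<Sum>i\<in>R. mean i 1)\<bar> \<le> (\<Sum>i\<in>R. \<bar>real (\<kappa> i) - mean i 1\<bar>)"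
      unfolding sum_subtractf[symmetric] by (rule sum_abs)
    also have "\<dots> \<le> \<delta>" unfolding mean1 \<delta>(1)[symmetric] by (rule sum_mono2) auto
    finally show ?thesis .
  qed
  have "(1 - \<delta>) ^ card U * (\<Prod>i\<in>U. (x $ i) ^ \<kappa> i) * eval_rpoly p 1
      \<le> eval_rpoly p (\<chi> j. if j \<in> U then x $ j * 1 $ j else 1 $ j)"
  proof (rule eval_scale_coords_ge[where \<sigma> = 1])
    show "1 * ((\<Sum>i\<in>R. real (\<kappa> i)) - (\<Sum>i\<in>R. mean i 1)) \<le> \<delta>" for R
      using abs[of R] by (simp add: abs_le_iff)
  qed (use \<delta> \<delta>0 x in \<open>auto simp: U_def\<close>)
  then have up: "(1 - \<delta>) ^ card U * (\<Prod>i\<in>U. (x $ i) ^ \<kappa> i) \<le> eval_rpoly p z"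
    by (simp add: p1 z_def cong: if_cong)
  have "(1 - \<delta>) ^ card (- U) * (\<Prod>i\<in>- U. (x $ i) ^ \<kappa> i) * eval_rpoly p z
      \<le> eval_rpoly p (\<chi> j. if j \<in> - U then x $ j * z $ j else z $ j)"
  proof (rule eval_scale_coords_ge[where \<sigma> = "- 1"])
    fix R assume R: "R \<subseteq> - U"
    \<comment> \<open>Coordinates outside \<open>U\<close> are still 1 at \<open>z\<close> while
      others were raised, so their means did not increase; this is the direction the downward phase
      needs.\<close>
    have "mean i z \<le> mean i 1" if "i \<in> R" for i
      using R that by (intro mean_antimono_coord) (auto simp: z_def U_def)
    then have "(\<Sum>i\<in>R. mean i z) \<le> (\<Sum>i\<in>R. mean i 1)" by (rule sum_mono)
    then show "- 1 * ((\<Sum>i\<in>R. real (\<kappa> i)) - (\<Sum>i\<in>R. mean i z)) \<le> \<delta>"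
      using abs[of R] by (simp add: abs_le_iff)
  qed (use \<delta> \<delta>0 x in \<open>auto simp: U_def z_def\<close>)
  moreover have "(\<chi> j. if j \<in> - U then x $ j * z $ j else z $ j) = x"
    by (auto simp: vec_eq_iff z_def)
  ultimately have down: "(1 - \<delta>) ^ card (- U) * (\<Prod>i\<in>- U. (x $ i) ^ \<kappa> i) * eval_rpoly p z
      \<le> eval_rpoly p x" by simp
  have "CARD('n) = card (- U) + card U"
    by (subst card_Un_disjoint[symmetric]) (auto simp: Compl_partition2)
  moreover have "(\<Prod>i\<in>UNIV. (x $ i) ^ \<kappa> i) = (\<Prod>i\<in>- U. (x $ i) ^ \<kappa> i) * (\<Prod>i\<in>U. (x $ i) ^ \<kappa> i)"
    by (subst prod.union_disjoint[symmetric]) (auto simp: Compl_partition2)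
  ultimately have "(1 - \<delta>) ^ CARD('n) * (\<Prod>i\<in>UNIV. (x $ i) ^ \<kappa> i) =
      ((1 - \<delta>) ^ card (- U) * (\<Prod>i\<in>- U. (x $ i) ^ \<kappa> i)) * ((1 - \<delta>) ^ card U * (\<Prod>i\<in>U. (x $ i) ^ \<kappa> i))"
    by (simp add: power_add mult_ac)
  also have "\<dots> \<le> ((1 - \<delta>) ^ card (- U) * (\<Prod>i\<in>- U. (x $ i) ^ \<kappa> i)) * eval_rpoly p z"
    using \<delta> less_imp_le[OF x]
    by (intro mult_left_mono up mult_nonneg_nonneg prod_nonneg zero_le_power ballI) auto
  also note down
  finally show ?thesis .
qed

end

section \<open>The extremal polynomials\<close>

lemma rpoly_sum_monomials: "p = (\<Sum>m\<in>Poly_Mapping.keys p. Poly_Mapping.single m (Poly_Mapping.lookup p m))"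
  by (rule poly_mapping_eqI) (simp add: lookup_sum lookup_single when_def in_keys_iff)

lemma eval_rpoly_superset:
  assumes "finite A" "Poly_Mapping.keys p \<subseteq> A"
  shows "eval_rpoly p x = (\<Sum>m\<in>A. of_real (Poly_Mapping.lookup p m) * monomial_at x m)"
  unfolding eval_rpoly_def using assms
  by (intro sum.mono_neutral_left) (auto simp: in_keys_iff)

lemma eval_rpoly_single: "eval_rpoly (Poly_Mapping.single m c) x = of_real c * monomial_at x m"
  using eval_rpoly_superset[of "{m}" "Poly_Mapping.single m c" x] by simp

lemma eval_rpoly_add: "eval_rpoly (p + q) x = eval_rpoly p x + eval_rpoly q x"
proof -
  let ?A = "Poly_Mapping.keys p \<union> Poly_Mapping.keys q"
  have "eval_rpoly (p + q) x = (\<Sum>m\<in>?A. of_real (Poly_Mapping.lookup (p + q) m) * monomial_at x m)"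
    by (rule eval_rpoly_superset) (auto simp: Poly_Mapping.keys_add)
  also have "\<dots> = eval_rpoly p x + eval_rpoly q x"
    by (simp add: eval_rpoly_superset[of ?A] lookup_add distrib_right sum.distrib)
  finally show ?thesis .
qed

lemma eval_rpoly_0: "eval_rpoly 0 x = 0"
  by (simp add: eval_rpoly_def)

lemma eval_rpoly_sum: "eval_rpoly (\<Sum>a\<in>A. f a) x = (\<Sum>a\<in>A. eval_rpoly (f a) x)"
  by (induction A rule: infinite_finite_induct) (simp_all add: eval_rpoly_add eval_rpoly_0)

text \<open>Through this expansion, multiplicativity of evaluation and closure of nonnegative
  coefficients under products both reduce to single monomials.\<close>

lemma rpoly_mult_monomials:
  fixes p q :: "'n rpoly"
  shows "p * q = (\<Sum>m\<in>Poly_Mapping.keys p. \<Sum>l\<in>Poly_Mapping.keys q.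
    Poly_Mapping.single (m + l) (Poly_Mapping.lookup p m * Poly_Mapping.lookup q l))"
  by (subst rpoly_sum_monomials[of p], subst rpoly_sum_monomials[of q])
    (simp add: sum_product mult_single)

lemma monomial_at_add: "monomial_at x (m + l) = monomial_at x m * monomial_at x l"
  by (simp add: lookup_add power_add prod.distrib)

lemma eval_rpoly_mult: "eval_rpoly (p * q) x = eval_rpoly p x * eval_rpoly q x"
proof -
  have "eval_rpoly (p * q) x = (\<Sum>m\<in>Poly_Mapping.keys p. \<Sum>l\<in>Poly_Mapping.keys q.
      (of_real (Poly_Mapping.lookup p m) * monomial_at x m) * (of_real (Poly_Mapping.lookup q l) * monomial_at x l))"
    unfolding rpoly_mult_monomials eval_rpoly_sum eval_rpoly_single monomial_at_add
    by (simp add: mult_ac)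
  also have "\<dots> = eval_rpoly p x * eval_rpoly q x"
    unfolding eval_rpoly_def by (rule sum_product[symmetric])
  finally show ?thesis .
qed

lemma eval_rpoly_1: "eval_rpoly 1 x = 1"
  using eval_rpoly_single[of 0 1 x] by simp

lemma eval_rpoly_prod: "eval_rpoly (\<Prod>a\<in>A. f a) x = (\<Prod>a\<in>A. eval_rpoly (f a) x)"
  by (induction A rule: infinite_finite_induct) (simp_all add: eval_rpoly_mult eval_rpoly_1)

lemma monomial_at_single: "monomial_at x (Poly_Mapping.single i k) = (x $ i) ^ k"
proof -
  have "monomial_at x (Poly_Mapping.single i k) = (\<Prod>j\<in>UNIV. if i = j then (x $ j) ^ k else 1)"
    by (rule prod.cong) (auto simp: lookup_single when_def)
  then show ?thesis by simp
qed

lemma nonneg_coeffs_single: "c \<ge> 0 \<Longrightarrow> nonneg_coeffs (Poly_Mapping.single m c)"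
  by (simp add: nonneg_coeffs_def lookup_single when_def)

lemma nonneg_coeffs_add: "nonneg_coeffs p \<Longrightarrow> nonneg_coeffs q \<Longrightarrow> nonneg_coeffs (p + q)"
  by (simp add: nonneg_coeffs_def lookup_add)

lemma nonneg_coeffs_sum: "(\<And>a. a \<in> A \<Longrightarrow> nonneg_coeffs (f a)) \<Longrightarrow> nonneg_coeffs (\<Sum>a\<in>A. f a)"
  by (simp add: nonneg_coeffs_def lookup_sum sum_nonneg)

lemma nonneg_coeffs_mult: "nonneg_coeffs p \<Longrightarrow> nonneg_coeffs q \<Longrightarrow> nonneg_coeffs (p * q)"
  unfolding rpoly_mult_monomials
  by (intro nonneg_coeffs_sum nonneg_coeffs_single) (simp add: nonneg_coeffs_def)

lemma nonneg_coeffs_prod: "(\<And>a. a \<in> A \<Longrightarrow> nonneg_coeffs (f a)) \<Longrightarrow> nonneg_coeffs (\<Prod>a\<in>A. f a)"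
proof (induction A rule: infinite_finite_induct)
  case (insert a A)
  then show ?case by (simp add: nonneg_coeffs_mult)
qed (simp_all add: nonneg_coeffs_def lookup_one when_def)

text \<open>The extremal polynomial is a product of links \<open>\<epsilon> * x (e j) + (1 - \<epsilon>) * x (e (j - 1))\<close> along an
  enumeration \<open>e\<close> of the variables, starting from the constant \<open>1\<close>.\<close>

definition chain_pred :: "(nat \<Rightarrow> 'n) \<Rightarrow> 'a::one ^ 'n \<Rightarrow> nat \<Rightarrow> 'a" where
  "chain_pred e x j = (case j of 0 \<Rightarrow> 1 | Suc l \<Rightarrow> x $ e l)"

definition chain_link :: "(nat \<Rightarrow> 'n) \<Rightarrow> real \<Rightarrow> nat \<Rightarrow> 'n rpoly" where
  "chain_link e \<epsilon> j = Poly_Mapping.single (Poly_Mapping.single (e j) 1) \<epsilon> +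
     Poly_Mapping.single (case j of 0 \<Rightarrow> 0 | Suc l \<Rightarrow> Poly_Mapping.single (e l) 1) (1 - \<epsilon>)"

text \<open>The exponents \<open>k\<close> are later \<kappa> minus 1, which is where strictly
  positive entries are required: dividing by the monomial of exponent \<kappa> leaves one factor
  \<open>x (e j)\<close> under each link.\<close>

definition chain_poly :: "(nat \<Rightarrow> 'n::finite) \<Rightarrow> ('n \<Rightarrow> nat) \<Rightarrow> real \<Rightarrow> 'n rpoly" where
  "chain_poly e k \<epsilon> = (\<Prod>j<CARD('n). Poly_Mapping.single (Poly_Mapping.single (e j) (k (e j))) 1 * chain_link e \<epsilon> j)"

lemma eval_chain_poly:
  fixes x :: "'a::real_normed_field ^ 'n::finite"
  shows "eval_rpoly (chain_poly e k \<epsilon>) x =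
    (\<Prod>j<CARD('n). (x $ e j) ^ k (e j) * (of_real \<epsilon> * x $ e j + of_real (1 - \<epsilon>) * chain_pred e x j))"
proof -
  have "eval_rpoly (chain_link e \<epsilon> j) x = of_real \<epsilon> * x $ e j + of_real (1 - \<epsilon>) * chain_pred e x j" for j
    by (cases j) (simp_all add: chain_link_def chain_pred_def eval_rpoly_add eval_rpoly_single monomial_at_single)
  then show ?thesis
    by (simp add: chain_poly_def eval_rpoly_prod eval_rpoly_mult eval_rpoly_single monomial_at_single)
qed

lemma nonneg_coeffs_chain_poly:
  assumes "0 \<le> \<epsilon>" "\<epsilon> \<le> 1"
  shows "nonneg_coeffs (chain_poly e k \<epsilon>)"
  unfolding chain_poly_def chain_link_def using assms
  by (intro nonneg_coeffs_prod nonneg_coeffs_mult nonneg_coeffs_add nonneg_coeffs_single) auto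

text \<open>On the upper half plane every link has positive imaginary part, since
  \<open>\<epsilon> > 0\<close> and the predecessor is either another coordinate or the real
  constant 1.\<close>

lemma real_stable_chain_poly:
  fixes e :: "nat \<Rightarrow> 'n::finite"
  assumes "0 < \<epsilon>" "\<epsilon> \<le> 1"
  shows "real_stable (chain_poly e k \<epsilon>)"
  unfolding real_stable_def
proof (intro allI impI)
  fix z :: "complex ^ 'n" assume z: "\<forall>i. Im (z $ i) > 0"
  have "z $ i \<noteq> 0" for i using z by (metis less_irrefl zero_complex.sel(2))
  moreover have "of_real \<epsilon> * z $ e j + of_real (1 - \<epsilon>) * chain_pred e z j \<noteq> 0" for j
  proof -
    have "Im (chain_pred e z j) \<ge> 0" using z by (cases j) (auto simp: chain_pred_def less_imp_le)
    then have "\<epsilon> * Im (z $ e j) + (1 - \<epsilon>) * Im (chain_pred e z j) > 0"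
      using z assms by (intro add_pos_nonneg mult_pos_pos mult_nonneg_nonneg) auto
    then have "Im (of_real \<epsilon> * z $ e j + of_real (1 - \<epsilon>) * chain_pred e z j) > 0" by simp
    then show ?thesis by (metis less_irrefl zero_complex.sel(2))
  qed
  ultimately show "eval_rpoly (chain_poly e k \<epsilon>) z \<noteq> 0"
    by (simp add: eval_chain_poly)
qed

text \<open>Every factor is 1 at the all-ones vector, so the product rule adds the gradients of the
  factors. A variable receives \<open>k\<close> from its power, \<epsilon> from its own link and
  \<open>1 - \<epsilon>\<close> from the next link; only the last variable has no next link.\<close>

lemma gradient_chain_poly:
  fixes e :: "nat \<Rightarrow> 'n::finite"
  assumes e: "bij_betw e {..<CARD('n)} UNIV"
  shows "gradient (eval_rpoly (chain_poly e k \<epsilon>)) (1 :: real ^ 'n) =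
    (\<chi> i. real (k i) + 1 - (if i = e (CARD('n) - 1) then 1 - \<epsilon> else 0))"
proof (rule gradient_eqI, unfold gderiv_def)
  obtain N where N: "CARD('n) = Suc N" by (metis card_eq_0_iff finite UNIV_not_empty not0_implies_Suc)
  let ?D = "\<lambda>h :: real ^ 'n. \<lambda>j. real (k (e j)) * h $ e j + (\<epsilon> * h $ e j + (1 - \<epsilon>) * (case j of 0 \<Rightarrow> 0 | Suc l \<Rightarrow> h $ e l))"
  have coord: "((\<lambda>y :: real ^ 'n. y $ i) has_derivative (\<lambda>h. h $ i)) (at 1)" for i
    by (rule bounded_linear.has_derivative[OF bounded_linear_vec_nth has_derivative_ident])
  have pred: "((\<lambda>y :: real ^ 'n. chain_pred e y j) has_derivative (\<lambda>h. case j of 0 \<Rightarrow> 0 | Suc l \<Rightarrow> h $ e l)) (at 1)" for j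
    by (cases j) (simp_all add: chain_pred_def coord)
  have pred1: "chain_pred e 1 j = (1 :: real)" for j
    by (cases j) (simp_all add: chain_pred_def)
  have "((\<lambda>y :: real ^ 'n. (y $ e j) ^ k (e j) * (\<epsilon> * y $ e j + (1 - \<epsilon>) * chain_pred e y j))
      has_derivative (\<lambda>h. ?D h j)) (at 1)" for j
    by (rule has_derivative_eq_rhs[OF has_derivative_mult[OF has_derivative_power[OF coord]
          has_derivative_add[OF has_derivative_mult_right[OF coord] has_derivative_mult_right[OF pred]]]])
      (simp add: fun_eq_iff pred1 algebra_simps)
  then have "(eval_rpoly (chain_poly e k \<epsilon>) has_derivative
      (\<lambda>h. \<Sum>j<CARD('n). ?D h j * (\<Prod>l\<in>{..<CARD('n)} - {j}. (1 :: real ^ 'n) $ e l ^ k (e l) *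
         (\<epsilon> * 1 $ e l + (1 - \<epsilon>) * chain_pred e 1 l)))) (at (1 :: real ^ 'n))"
    unfolding eval_chain_poly[abs_def] of_real_eq_id id_apply by (intro has_derivative_prod)
  then have deriv: "(eval_rpoly (chain_poly e k \<epsilon>) has_derivative (\<lambda>h. \<Sum>j<CARD('n). ?D h j)) (at (1 :: real ^ 'n))"
    by (simp add: pred1)
  have "(\<Sum>j<CARD('n). ?D h j) =
      inner h (\<chi> i. real (k i) + 1 - (if i = e (CARD('n) - 1) then 1 - \<epsilon> else 0))" for h
  proof -
    have reindex: "(\<Sum>j<CARD('n). f (e j)) = (\<Sum>i\<in>UNIV. f i)" for f :: "'n \<Rightarrow> real"
      using sum.reindex_bij_betw[OF e] .
    \<comment> \<open>The predecessor of index 0 is constant and contributes nothing, so the sum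
      over predecessors meets every variable except the last.\<close>
    have shift: "(\<Sum>j<CARD('n). case j of 0 \<Rightarrow> 0 | Suc l \<Rightarrow> h $ e l) = (\<Sum>i\<in>UNIV. h $ i) - h $ e N"
    proof -
      have "(\<Sum>j<CARD('n). case j of 0 \<Rightarrow> 0 | Suc l \<Rightarrow> h $ e l) = (\<Sum>j<N. h $ e j)"
        unfolding N by (subst sum.lessThan_Suc_shift) simp
      moreover have "(\<Sum>i\<in>UNIV. h $ i) = (\<Sum>j<N. h $ e j) + h $ e N"
        using reindex[of "\<lambda>i. h $ i"] unfolding N by simp
      ultimately show ?thesis by simp
    qed
    have "(\<Sum>j<CARD('n). ?D h j) = (\<Sum>i\<in>UNIV. real (k i) * h $ i) + (\<epsilon> * (\<Sum>i\<in>UNIV. h $ i) +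
        (1 - \<epsilon>) * ((\<Sum>i\<in>UNIV. h $ i) - h $ e N))"
      unfolding sum.distrib sum_distrib_left[symmetric] shift
      by (simp only: reindex[of "\<lambda>i. real (k i) * h $ i"] reindex[of "\<lambda>i. h $ i"])
    also have "\<dots> = (\<Sum>i\<in>UNIV. real (k i) * h $ i) + (\<Sum>i\<in>UNIV. h $ i) - (1 - \<epsilon>) * h $ e N"
      by (simp add: algebra_simps)
    also have "(1 - \<epsilon>) * h $ e N = (\<Sum>i\<in>UNIV. h $ i * (if i = e N then 1 - \<epsilon> else 0))"
      by (simp add: if_distrib cong: if_cong)
    also have "(\<Sum>i\<in>UNIV. real (k i) * h $ i) + (\<Sum>i\<in>UNIV. h $ i) - (\<Sum>i\<in>UNIV. h $ i * (if i = e N then 1 - \<epsilon> else 0)) =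
        (\<Sum>i\<in>UNIV. h $ i * (real (k i) + 1 - (if i = e N then 1 - \<epsilon> else 0)))"
      unfolding sum.distrib[symmetric] sum_subtractf[symmetric]
      by (intro sum.cong refl) (simp add: algebra_simps)
    finally show ?thesis by (simp add: inner_vec_def N)
  qed
  with deriv show "(eval_rpoly (chain_poly e k \<epsilon>) has_derivative
      (\<lambda>h. inner h (\<chi> i. real (k i) + 1 - (if i = e (CARD('n) - 1) then 1 - \<epsilon> else 0)))) (at (1 :: real ^ 'n))"
    by simp
qed

lemma chain_poly_quotient:
  fixes e :: "nat \<Rightarrow> 'n::finite" and x :: "real ^ 'n" and \<kappa> :: "int ^ 'n"
  assumes e: "bij_betw e {..<CARD('n)} UNIV" and x: "\<And>i. x $ i > 0" and \<kappa>: "\<And>i. \<kappa> $ i > 0"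
  shows "eval_rpoly (chain_poly e (\<lambda>i. nat (\<kappa> $ i) - 1) \<epsilon>) x / (\<Prod>i\<in>UNIV. (x $ i) powi (\<kappa> $ i)) =
    (\<Prod>j<CARD('n). \<epsilon> + (1 - \<epsilon>) * (chain_pred e x j / x $ e j))"
proof -
  \<comment> \<open>Positivity of \<kappa> keeps the subtraction
    \<open>nat (\<kappa> $ i) - 1\<close> from truncating.\<close>
  have powi: "(x $ i) powi (\<kappa> $ i) = (x $ i) ^ (nat (\<kappa> $ i) - 1) * x $ i" for i
    using \<kappa>[of i] by (simp add: power_int_def flip: power_Suc2)
  have "(\<Prod>i\<in>UNIV. (x $ i) powi (\<kappa> $ i)) = (\<Prod>j<CARD('n). (x $ e j) ^ (nat (\<kappa> $ e j) - 1) * x $ e j)"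
    unfolding powi by (rule prod.reindex_bij_betw[OF e, symmetric])
  then have "eval_rpoly (chain_poly e (\<lambda>i. nat (\<kappa> $ i) - 1) \<epsilon>) x / (\<Prod>i\<in>UNIV. (x $ i) powi (\<kappa> $ i)) =
      (\<Prod>j<CARD('n). (x $ e j) ^ (nat (\<kappa> $ e j) - 1) * (\<epsilon> * x $ e j + (1 - \<epsilon>) * chain_pred e x j) /
        ((x $ e j) ^ (nat (\<kappa> $ e j) - 1) * x $ e j))"
    by (simp only: eval_chain_poly of_real_eq_id id_apply prod_dividef)
  also have "\<dots> = (\<Prod>j<CARD('n). \<epsilon> + (1 - \<epsilon>) * (chain_pred e x j / x $ e j))"
  proof (rule prod.cong[OF refl])
    fix j
    show "(x $ e j) ^ (nat (\<kappa> $ e j) - 1) * (\<epsilon> * x $ e j + (1 - \<epsilon>) * chain_pred e x j) /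
        ((x $ e j) ^ (nat (\<kappa> $ e j) - 1) * x $ e j) = \<epsilon> + (1 - \<epsilon>) * (chain_pred e x j / x $ e j)"
      using x[of "e j"] by (simp add: add_divide_distrib)
  qed
  finally show ?thesis .
qed

lemma positive_vec_nonempty: "{x :: real ^ 'n. \<forall>i. x $ i > 0} \<noteq> {}"
proof -
  have "1 \<in> {x :: real ^ 'n. \<forall>i. x $ i > 0}" by simp
  then show ?thesis by blast
qed

text \<open>Every factor of the quotient is \<epsilon> plus a nonnegative multiple of a ratio of
  consecutive variables. All ratios can be made small at once by letting the variables grow
  geometrically along the enumeration.\<close>

lemma capacity_chain_poly:
  fixes e :: "nat \<Rightarrow> 'n::finite" and \<kappa> :: "int ^ 'n"
  assumes e: "bij_betw e {..<CARD('n)} UNIV" and \<kappa>: "\<And>i. \<kappa> $ i > 0" and \<epsilon>: "0 < \<epsilon>" "\<epsilon> \<le> 1"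
  shows "capacity \<kappa> (chain_poly e (\<lambda>i. nat (\<kappa> $ i) - 1) \<epsilon>) = \<epsilon> ^ CARD('n)"
proof -
  let ?q = "\<lambda>x :: real ^ 'n. eval_rpoly (chain_poly e (\<lambda>i. nat (\<kappa> $ i) - 1) \<epsilon>) x / (\<Prod>i\<in>UNIV. (x $ i) powi (\<kappa> $ i))"
  let ?X = "{x :: real ^ 'n. \<forall>i. x $ i > 0}"
  have lower: "\<epsilon> ^ CARD('n) \<le> ?q x" if "x \<in> ?X" for x
  proof -
    have x: "x $ i > 0" for i using that by simp
    have "(\<Prod>j<CARD('n). \<epsilon>) \<le> (\<Prod>j<CARD('n). \<epsilon> + (1 - \<epsilon>) * (chain_pred e x j / x $ e j))"
    proof (intro prod_mono conjI)
      fix j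
      have "chain_pred e x j \<ge> 0" using x by (cases j) (auto simp: chain_pred_def less_imp_le)
      then have "(1 - \<epsilon>) * (chain_pred e x j / x $ e j) \<ge> 0"
        using x[of "e j"] \<epsilon> by (intro mult_nonneg_nonneg divide_nonneg_pos) auto
      then show "\<epsilon> \<le> \<epsilon> + (1 - \<epsilon>) * (chain_pred e x j / x $ e j)" by simp
    qed (use \<epsilon> in auto)
    then show ?thesis unfolding chain_poly_quotient[OF e x \<kappa>] by simp
  qed
  have bdd: "bdd_below (?q ` ?X)" using lower by (rule bdd_belowI2)
  have upper: "capacity \<kappa> (chain_poly e (\<lambda>i. nat (\<kappa> $ i) - 1) \<epsilon>) \<le> (\<epsilon> + (1 - \<epsilon>) * (1 / R)) ^ CARD('n)"
    if R: "R > 0" for R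
  proof -
    \<comment> \<open>\<open>inv_into\<close> gives the position of a variable in the enumeration.
      The exponent starts at 1, so the first ratio, whose numerator is the constant 1, is also
      \<open>1 / R\<close>.\<close>
    define x :: "real ^ 'n" where "x = (\<chi> i. R ^ Suc (inv_into {..<CARD('n)} e i))"
    have x: "x $ i > 0" for i using R by (simp add: x_def)
    have x_e: "x $ e j = R ^ Suc j" if "j < CARD('n)" for j
      using inv_into_f_f[OF bij_betw_imp_inj_on[OF e], of j] that by (simp add: x_def)
    have "chain_pred e x j / x $ e j = 1 / R" if "j < CARD('n)" for j
      using that R by (cases j) (simp_all add: chain_pred_def x_e)
    then have "?q x = (\<epsilon> + (1 - \<epsilon>) * (1 / R)) ^ CARD('n)"
      unfolding chain_poly_quotient[OF e x \<kappa>] by simp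
    moreover have "capacity \<kappa> (chain_poly e (\<lambda>i. nat (\<kappa> $ i) - 1) \<epsilon>) \<le> ?q x"
      unfolding capacity_def using x by (intro cINF_lower bdd) simp
    ultimately show ?thesis by simp
  qed
  have "((\<lambda>R. (\<epsilon> + (1 - \<epsilon>) * (1 / R)) ^ CARD('n)) \<longlongrightarrow> (\<epsilon> + (1 - \<epsilon>) * 0) ^ CARD('n)) at_top"
    by (intro tendsto_intros tendsto_divide_0[OF tendsto_const] filterlim_at_top_imp_at_infinity filterlim_ident)
  moreover have "\<forall>\<^sub>F R in at_top. capacity \<kappa> (chain_poly e (\<lambda>i. nat (\<kappa> $ i) - 1) \<epsilon>) \<le> (\<epsilon> + (1 - \<epsilon>) * (1 / R)) ^ CARD('n)"
    using eventually_gt_at_top[of 0] by (rule eventually_mono) (rule upper)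
  ultimately have "capacity \<kappa> (chain_poly e (\<lambda>i. nat (\<kappa> $ i) - 1) \<epsilon>) \<le> (\<epsilon> + (1 - \<epsilon>) * 0) ^ CARD('n)"
    by (rule tendsto_lowerbound) simp
  moreover have "\<epsilon> ^ CARD('n) \<le> capacity \<kappa> (chain_poly e (\<lambda>i. nat (\<kappa> $ i) - 1) \<epsilon>)"
    unfolding capacity_def by (rule cINF_greatest[OF positive_vec_nonempty lower])
  ultimately show ?thesis by simp
qed

lemma capacity_bound_attained:
  fixes \<kappa> :: "int ^ 'n::finite"
  assumes \<kappa>: "\<And>i. \<kappa> $ i > 0" and \<epsilon>: "0 < \<epsilon>" "\<epsilon> \<le> 1"
  shows "\<exists>p :: 'n rpoly. nonneg_coeffs p \<and> real_stable p \<and> eval_rpoly p (1 :: real ^ 'n) = 1 \<and>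
    l1_norm (real_vec \<kappa> - gradient (eval_rpoly p) 1) = 1 - \<epsilon> \<and> capacity \<kappa> p = \<epsilon> ^ CARD('n)"
proof -
  obtain e where e: "bij_betw e {..<CARD('n)} (UNIV :: 'n set)"
    using ex_bij_betw_nat_finite[of "UNIV :: 'n set"] by (auto simp: atLeast0LessThan)
  let ?p = "chain_poly e (\<lambda>i. nat (\<kappa> $ i) - 1) \<epsilon>"
  have "chain_pred e 1 j = (1 :: real)" for j
    by (cases j) (simp_all add: chain_pred_def)
  then have "eval_rpoly ?p (1 :: real ^ 'n) = 1"
    by (simp add: eval_chain_poly)
  moreover have "l1_norm (real_vec \<kappa> - gradient (eval_rpoly ?p) 1) = 1 - \<epsilon>"
  proof -
    \<comment> \<open>The \<open>+ 1\<close> in the gradient makes up for the exponents \<kappa>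
      minus 1, so the l1 distance comes from the last variable alone.\<close>
    have "(real_vec \<kappa> - gradient (eval_rpoly ?p) 1) $ i = (if i = e (CARD('n) - 1) then 1 - \<epsilon> else 0)" for i
      using \<kappa>[of i] by (simp add: gradient_chain_poly[OF e] real_vec_def of_nat_diff)
    then have "l1_norm (real_vec \<kappa> - gradient (eval_rpoly ?p) 1) =
        (\<Sum>i\<in>UNIV. if i = e (CARD('n) - 1) then \<bar>1 - \<epsilon>\<bar> else 0)"
      unfolding l1_norm_def by (intro sum.cong) auto
    then show ?thesis using \<epsilon> by simp
  qed
  ultimately show ?thesis
    using nonneg_coeffs_chain_poly[of \<epsilon> e] real_stable_chain_poly[OF \<epsilon>, of e] capacity_chain_poly[OF e \<kappa> \<epsilon>] \<epsilon>
    by (intro exI[of _ ?p]) simp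
qed

theorem theorem2p1:
  shows "(\<forall>(p :: 'n::finite rpoly) (\<kappa> :: int ^ 'n).
            nonneg_coeffs p \<longrightarrow> real_stable p \<longrightarrow> (\<forall>i. \<kappa> $ i \<ge> 0) \<longrightarrow>
            eval_rpoly p (1 :: real ^ 'n) = 1 \<longrightarrow>
            l1_norm (real_vec \<kappa> - gradient (eval_rpoly p) 1) < 1 \<longrightarrow>
            capacity \<kappa> p \<ge> (1 - l1_norm (real_vec \<kappa> - gradient (eval_rpoly p) 1)) ^ CARD('n))
       \<and> (\<forall>(\<kappa> :: int ^ 'n) (\<epsilon> :: real).
            (\<forall>i. \<kappa> $ i > 0) \<longrightarrow> 0 < \<epsilon> \<longrightarrow> \<epsilon> \<le> 1 \<longrightarrow>
            (\<exists>p :: 'n rpoly. nonneg_coeffs p \<and> real_stable p \<and> eval_rpoly p (1 :: real ^ 'n) = 1 \<and>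
               1 - l1_norm (real_vec \<kappa> - gradient (eval_rpoly p) 1) = \<epsilon> \<and>
               capacity \<kappa> p = (1 - l1_norm (real_vec \<kappa> - gradient (eval_rpoly p) 1)) ^ CARD('n)))"
proof (intro conjI allI impI)
  fix p :: "'n rpoly" and \<kappa> :: "int ^ 'n"
  assume p: "nonneg_coeffs p" "real_stable p" and \<kappa>: "\<forall>i. \<kappa> $ i \<ge> 0"
    and p1: "eval_rpoly p (1 :: real ^ 'n) = 1"
    and close: "l1_norm (real_vec \<kappa> - gradient (eval_rpoly p) 1) < 1"
  have "p \<noteq> 0" using p1 by (auto simp: eval_rpoly_0)
  then interpret nonneg_stable p using p by unfold_locales
  let ?\<delta> = "l1_norm (real_vec \<kappa> - gradient (eval_rpoly p) 1)"
  have \<delta>: "(\<Sum>i\<in>UNIV. \<bar>real (nat (\<kappa> $ i)) - partial_deriv p i (1 :: real ^ 'n)\<bar>) = ?\<delta>"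
    using \<kappa> by (simp add: l1_norm_def real_vec_def gradient_eval_rpoly)
  show "(1 - ?\<delta>) ^ CARD('n) \<le> capacity \<kappa> p"
    unfolding capacity_def
  proof (rule cINF_greatest[OF positive_vec_nonempty])
    fix x :: "real ^ 'n" assume "x \<in> {x. \<forall>i. x $ i > 0}"
    then have x: "x $ i > 0" for i by simp
    have "(x $ i) powi (\<kappa> $ i) = (x $ i) ^ nat (\<kappa> $ i)" for i
      using \<kappa> by (simp add: power_int_def)
    moreover have "(\<Prod>i\<in>UNIV. (x $ i) ^ nat (\<kappa> $ i)) > 0"
      by (intro prod_pos ballI zero_less_power x)
    ultimately show "(1 - ?\<delta>) ^ CARD('n) \<le> eval_rpoly p x / (\<Prod>i\<in>UNIV. (x $ i) powi (\<kappa> $ i))"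
      using eval_ge_prod_power[OF x p1 \<delta>] close by (simp add: pos_le_divide_eq)
  qed
next
  fix \<kappa> :: "int ^ 'n" and \<epsilon> :: real
  assume "\<forall>i. \<kappa> $ i > 0" "0 < \<epsilon>" "\<epsilon> \<le> 1"
  then obtain p :: "'n rpoly" where "nonneg_coeffs p" "real_stable p" "eval_rpoly p (1 :: real ^ 'n) = 1"
    "l1_norm (real_vec \<kappa> - gradient (eval_rpoly p) 1) = 1 - \<epsilon>" "capacity \<kappa> p = \<epsilon> ^ CARD('n)"
    using capacity_bound_attained[of \<kappa> \<epsilon>] by blast
  then show "\<exists>p :: 'n rpoly. nonneg_coeffs p \<and> real_stable p \<and> eval_rpoly p (1 :: real ^ 'n) = 1 \<and>
      1 - l1_norm (real_vec \<kappa> - gradient (eval_rpoly p) 1) = \<epsilon> \<and>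
      capacity \<kappa> p = (1 - l1_norm (real_vec \<kappa> - gradient (eval_rpoly p) 1)) ^ CARD('n)"
    by (intro exI[of _ p]) simp
qed

end
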